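(* Let $0<\alpha<1$ and $\varphi\in C^1([0,1])$. There are constants $C=C_{\alpha,\|\varphi\|_{C^1}}$ and $\widetilde C=\widetilde C_{\alpha,\|\varphi\|_{C^1}}$, depending only on $\alpha$ and on the $C^1$ norm of $\varphi$ (in particular not on the sequence of maps), such that for every sequence $(\alpha_j)_{j\ge1}$ with $0<\alpha_j\le\alpha$, with $\mathcal T^j:=T_{\alpha_j}\circ\cdots\circ T_{\alpha_1}$, every $\epsilon>0$, every $p>\max\{1,\frac1\alpha-1\}$ and every integer $n\ge2$: $$m\Big\{x:\Big|\sum_{j=1}^n[\varphi(\mathcal T^jx)-m(\varphi\circ\mathcal T^j)]\Big|>n\epsilon\Big\}\le\left(\frac{4p}{1-\frac1p(\frac1\alpha-1)}\right)^pC^p\,n^{1-\frac1\alpha}(\log n)^{\frac1\alpha}\epsilon^{-2p},$$ and moreover the moment estimate $$\int_0^1\Big|\sum_{j=1}^n[\varphi(\mathcal T^jx)-m(\varphi\circ\mathcal T^j)]\Big|^{2p}dm(x)\le\left(\frac{4p}{1-\frac1p(\frac1\alpha-1)}\right)^pC^p\,n^{2p+(1-\frac1\alpha)}(\log n)^{\frac1\alpha}$$ holds. The same two estimates hold with the measure $m$ replaced by $\widetilde m$, with each term centered as $\varphi(\mathcal T^jx)-\frac{1}{\widetilde m([0,1])}\widetilde m(\varphi\circ\mathcal T^j)$, and with $C$ replaced by $\widetilde C$.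
   Context: $m$ is Lebesgue measure on $[0,1]$, and $\mu(f)$ denotes $\int f\,d\mu$ for a measure $\mu$. For $\beta\in(0,1)$ the intermittent map $T_\beta:[0,1]\to[0,1]$ is $T_\beta(x)=x+2^\beta x^{1+\beta}$ for $0\le x\le 1/2$ and $T_\beta(x)=2x-1$ for $1/2<x\le1$. The measure $\widetilde m$ on $[0,1]$ is $d\widetilde m(x)=x^{-\alpha}\,dm(x)$ (a finite measure, not normalized). *)

theory Defs
  imports "HOL-Analysis.Analysis"
begin

text \<open>Only the values for \<open>x\<close> in \<open>{0..1}\<close> are meaningful. At \<open>x = 0\<close> the value is \<open>0\<close>,
  since \<open>0 powr b = 0\<close>.\<close>

definition intermittent_map :: "real \<Rightarrow> real \<Rightarrow> real" where
  "intermittent_map \<beta> x =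
     (if x \<le> 1/2 then x + 2 powr \<beta> * x powr (1 + \<beta>) else 2 * x - 1)"

text \<open>The parameter sequence is indexed from \<open>1\<close>; its value at \<open>0\<close> is never used.\<close>

primrec seq_comp :: "(nat \<Rightarrow> real) \<Rightarrow> nat \<Rightarrow> real \<Rightarrow> real" where
  "seq_comp a 0 = id"
| "seq_comp a (Suc j) = intermittent_map (a (Suc j)) \<circ> seq_comp a j"

abbreviation unit_lebesgue :: "real measure" where
  "unit_lebesgue \<equiv> lebesgue_on {0..1}"

definition weighted_lebesgue :: "real \<Rightarrow> real measure" where
  "weighted_lebesgue \<alpha> = density unit_lebesgue (\<lambda>x. ennreal (x powr (- \<alpha>)))"

text \<open>\<open>C1_differentiable_on\<close> from the library is not used here because it asks for two-sided
  derivatives at the endpoints, which depend on the values of \<open>\<phi>\<close> outside the interval.\<close>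

definition deriv01 :: "(real \<Rightarrow> real) \<Rightarrow> real \<Rightarrow> real" where
  "deriv01 \<phi> x = vector_derivative \<phi> (at x within {0..1})"

definition C1_on_unit :: "(real \<Rightarrow> real) \<Rightarrow> bool" where
  "C1_on_unit \<phi> \<longleftrightarrow> \<phi> differentiable_on {0..1} \<and> continuous_on {0..1} (deriv01 \<phi>)"

definition C1_norm :: "(real \<Rightarrow> real) \<Rightarrow> real" where
  "C1_norm \<phi> = (SUP x\<in>{0..1}. \<bar>\<phi> x\<bar>) + (SUP x\<in>{0..1}. \<bar>deriv01 \<phi> x\<bar>)"

end

(* Decreasing densities are preserved by every transfer operator, and the measure of [0, t] under
   a pushed-forward density stays of order t^(1-alpha). A positive fraction of the mass of [1/2, 1] is spread
   uniformly in one step, and all mass outside [0, e] with e ~ N^(-1/alpha) reaches [1/2, 1] within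
   N steps. So after N steps a constant close to a fixed fraction of the mass can be subtracted
   from two densities of equal mass, leaving decreasing remainders. Iterating with N proportional
   to the elapsed time gives loss of memory at the rate n^(1-1/alpha), without logarithm. A Rio-type
   moment inequality then bounds the moment of order 2q for q = max 1 (1/alpha - 1); all p > q follow since the
   sums are at most linear in n, and Markov's inequality gives the tails. *)
theory Submission
  imports Defs
begin

section \<open>Transfer operators on decreasing densities\<close>

text \<open>The maps change with time, so there is no common invariant density to converge to, and
  every estimate has to be uniform over all parameters up to \<alpha>. Hence only three properties
  of a density are tracked: monotonicity, total mass, and a bound
  \<open>B * t powr (1 - \<alpha>)\<close> on the mass of [0, t]. Each single operator respects all
  three, so no derivative of a density and no distortion estimate enters. The densities 1 and
  \<open>x powr - \<alpha>\<close> both qualify, which makes the two measures instances of one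
  weighted statement. Write s = 1 / \<alpha> - 1. The mass of [0, e] with e of order N^(-1/\<alpha>)
  is of order N^(-s), and this trapped mass fixes the rate. The state at time i determines all later
  terms of the sum but not the earlier ones, and loss of memory tests one early term against a
  bounded function of a later state. Therefore the sums are built up from the last term to the
  first. The moment order is 2q with q = max 1 s: a second order expansion asks for 2q >= 2, and
  this q yields n^(2q-s) up to logarithms, which the linear bound on the sums turns into
  n^(2p-s).\<close>

definition left_inv :: "real \<Rightarrow> real \<Rightarrow> real" where
  "left_inv b = inv_into {0..1/2} (intermittent_map b)"

section \<open>The left branch and its inverse\<close>

lemma intermittent_map_left:
  assumes "0 \<le> x" "x \<le> 1/2"
  shows "intermittent_map b x = x * (1 + (2 * x) powr b)"
  using assms by (cases "x = 0")
    (auto simp: intermittent_map_def powr_add powr_mult algebra_simps)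

context
  fixes b :: real
  assumes b: "0 < b"
begin

lemma intermittent_map_strict_mono: "strict_mono_on {0..1/2} (intermittent_map b)"
proof (rule strict_mono_onI)
  fix r s :: real assume rs: "r \<in> {0..1/2}" "s \<in> {0..1/2}" "r < s"
  have "(2 * r) powr b \<le> (2 * s) powr b" using rs b by (intro powr_mono2) auto
  then have "r * (1 + (2 * r) powr b) < s * (1 + (2 * s) powr b)"
    using rs by (intro mult_less_le_imp_less) (auto simp: add_pos_nonneg)
  then show "intermittent_map b r < intermittent_map b s"
    using rs by (simp add: intermittent_map_left)
qed

lemma intermittent_map_image: "intermittent_map b ` {0..1/2} = {0..1}"
proof -
  have c: "continuous_on {0..1/2} (\<lambda>x. x * (1 + (2 * x) powr b))"
    using b by (intro continuous_intros continuous_on_powr') auto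
  have c': "continuous_on {0..1/2} (intermittent_map b)"
    by (rule continuous_on_eq[OF c]) (auto simp: intermittent_map_left)
  have e: "intermittent_map b 0 = 0" "intermittent_map b (1/2) = 1"
    using intermittent_map_left[of 0 b] intermittent_map_left[of "1/2" b] by auto
  show ?thesis
  proof (intro equalityI subsetI)
    fix y assume "y \<in> intermittent_map b ` {0..1/2}"
    then obtain x where x: "x \<in> {0..1/2}" "y = intermittent_map b x" by auto
    have "intermittent_map b x \<le> intermittent_map b (1/2)" "intermittent_map b 0 \<le> intermittent_map b x"
      using strict_mono_on_leD[OF intermittent_map_strict_mono] x by auto
    then show "y \<in> {0..1}" using x e by auto
  next
    fix y :: real assume "y \<in> {0..1}"
    then show "y \<in> intermittent_map b ` {0..1/2}"
      using IVT'[OF _ _ _ c', of y] e by fastforce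
  qed
qed

lemma intermittent_map_inj: "inj_on (intermittent_map b) {0..1/2}"
  using intermittent_map_strict_mono strict_mono_on_imp_inj_on by blast

lemma intermittent_map_range: "x \<in> {0..1} \<Longrightarrow> intermittent_map b x \<in> {0..1}"
  using intermittent_map_image by (cases "x \<le> 1/2") (auto simp: intermittent_map_def)

lemma left_inv_range: "x \<in> {0..1} \<Longrightarrow> left_inv b x \<in> {0..1/2}"
  unfolding left_inv_def by (metis intermittent_map_image inv_into_into)

lemma map_left_inv: "x \<in> {0..1} \<Longrightarrow> intermittent_map b (left_inv b x) = x"
  unfolding left_inv_def by (metis intermittent_map_image f_inv_into_f)

lemma left_inv_map: "x \<in> {0..1/2} \<Longrightarrow> left_inv b (intermittent_map b x) = x"
  unfolding left_inv_def by (simp add: inv_into_f_f[OF intermittent_map_inj])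

lemma left_inv_eq: "x \<in> {0..1} \<Longrightarrow> left_inv b x * (1 + (2 * left_inv b x) powr b) = x"
  using map_left_inv[of x] left_inv_range[of x] by (simp add: intermittent_map_left)

lemma left_inv_mono:
  assumes "x \<in> {0..1}" "y \<in> {0..1}" "x \<le> y"
  shows "left_inv b x \<le> left_inv b y"
proof (rule ccontr)
  assume "\<not> left_inv b x \<le> left_inv b y"
  then have "intermittent_map b (left_inv b y) < intermittent_map b (left_inv b x)"
    using strict_mono_onD[OF intermittent_map_strict_mono] left_inv_range assms by auto
  then show False using assms map_left_inv by auto
qed

lemma left_inv_pos: "x \<in> {0<..1} \<Longrightarrow> 0 < left_inv b x"
  using left_inv_eq[of x] left_inv_range[of x] by (cases "left_inv b x = 0") auto

lemma intermittent_map_le_iff: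
  assumes "x \<in> {0..1/2}" "t \<in> {0..1}"
  shows "intermittent_map b x \<le> t \<longleftrightarrow> x \<le> left_inv b t"
  using strict_mono_on_less_eq[OF intermittent_map_strict_mono, of x "left_inv b t"]
    left_inv_range[of t] map_left_inv[of t] assms by auto

lemma intermittent_map_deriv:
  assumes "x \<in> {0..1/2}"
  shows "(intermittent_map b has_field_derivative 1 + (1 + b) * (2 * x) powr b) (at x within {0..1/2})"
proof (cases "x = 0")
  case True
  \<comment> \<open>At 0 the difference quotient is exactly \<open>1 + (2 * y) powr b\<close>, which
    converges because b > 0; at positive points the product rule applies.\<close>
  have "((\<lambda>y. 1 + (2 * y) powr b) \<longlongrightarrow> 1 + (2 * 0) powr b) (at 0 within {0..1/2})"
    using b by (intro tendsto_intros tendsto_powr') (auto simp: eventually_at_filter)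
  then have "((\<lambda>y. (intermittent_map b y - intermittent_map b 0) / (y - 0)) \<longlongrightarrow> 1 + (2 * 0) powr b) (at 0 within {0..1/2})"
    by (rule Lim_transform_within[where d=1]) (auto simp: intermittent_map_left)
  then show ?thesis using True by (simp add: has_field_derivative_iff)
next
  case False
  then have x: "0 < x" "x \<le> 1/2" using assms by auto
  have "((\<lambda>x. x * (1 + (2 * x) powr b)) has_field_derivative 1 + (1 + b) * (2 * x) powr b) (at x within {0..1/2})"
    using x by (auto intro!: derivative_eq_intros simp: field_simps powr_diff)
  then show ?thesis
    by (rule has_field_derivative_transform_within[where d=1])
      (use x in \<open>auto simp: intermittent_map_left\<close>)
qed

end

section \<open>The transfer operator of one map\<close>

lemma intermittent_map_borel [measurable]: "intermittent_map b \<in> borel_measurable borel"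
  unfolding intermittent_map_def[abs_def] by measurable

text \<open>The Perron-Frobenius operator: the denominators are the derivatives of the two branches
  at the two preimages of x. It acts on genuine functions, not on classes modulo null sets, so that
  monotonicity and lower bounds can be stated pointwise.\<close>

definition transfer :: "real \<Rightarrow> (real \<Rightarrow> real) \<Rightarrow> real \<Rightarrow> real" where
  "transfer b f x = f (left_inv b x) / (1 + (1 + b) * (2 * left_inv b x) powr b) + f ((x + 1) / 2) / 2"

text \<open>The point 0 is left out because \<open>0 powr (- \<alpha>)\<close> evaluates to 0, so
  the weight \<open>x powr - \<alpha>\<close> is not decreasing on the closed interval.\<close>

definition decr_density :: "(real \<Rightarrow> real) \<Rightarrow> bool" where
  "decr_density f \<longleftrightarrow> f absolutely_integrable_on {0..1} \<and> (\<forall>x\<in>{0<..1}. 0 \<le> f x) \<and> antimono_on {0<..1} f"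

lemma absolutely_integrable_mult_bounded:
  fixes f g :: "real \<Rightarrow> real"
  assumes "f absolutely_integrable_on S" "S \<in> sets lebesgue" "g \<in> borel_measurable borel"
    "\<And>x. x \<in> S \<Longrightarrow> \<bar>g x\<bar> \<le> L"
  shows "(\<lambda>x. f x * g x) absolutely_integrable_on S"
proof -
  have "(\<lambda>x. g x * f x) absolutely_integrable_on S"
  proof (rule absolutely_integrable_bounded_measurable_product_real)
    have "g \<in> borel_measurable lebesgue"
      using assms(3) by (intro measurable_completion) simp
    then show "g \<in> borel_measurable (lebesgue_on S)" by (rule measurable_restrict_space1)
    show "bounded (g ` S)" using assms(4) by (auto simp: bounded_iff)
  qed (use assms in auto)
  then show ?thesis by (simp add: mult.commute)
qed

text \<open>Change of variables on each branch separately. The test function is Borel, a class that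
  is stable under composition with the maps, so the identity can be iterated.\<close>

lemma transfer_duality:
  assumes b: "0 < b" and f: "f absolutely_integrable_on {0..1}"
    and g: "g \<in> borel_measurable borel" "\<And>x. \<bar>g x\<bar> \<le> L"
  shows "(\<lambda>x. transfer b f x * g x) absolutely_integrable_on {0..1}" (is ?th1)
    and "integral {0..1} (\<lambda>x. transfer b f x * g x) = integral {0..1} (\<lambda>x. f x * g (intermittent_map b x))" (is ?th2)
proof -
  let ?T = "intermittent_map b"
  let ?D = "\<lambda>x. 1 + (1 + b) * (2 * x) powr b"
  have D: "?D x > 0" for x using b by (auto intro!: add_pos_nonneg)
  have gT: "(\<lambda>x. g (?T x)) \<in> borel_measurable borel" using g by measurable
  have fg: "(\<lambda>x. f x * g (?T x)) absolutely_integrable_on {0..1}"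
    using absolutely_integrable_mult_bounded[OF f _ gT, of L] g(2) by auto
  have fg1: "(\<lambda>x. f x * g (?T x)) absolutely_integrable_on {0..1/2}"
    by (rule absolutely_integrable_on_subinterval[OF fg]) auto
  have fg2: "(\<lambda>x. f x * g (?T x)) absolutely_integrable_on {1/2..1}"
    by (rule absolutely_integrable_on_subinterval[OF fg]) auto
  \<comment> \<open>The two closed half intervals share the point 1/2, where the map has the
    left-branch value 1 while \<open>2 * x - 1\<close> is 0.\<close>
  have neg: "negligible {1/2::real}" by simp
  have fg2': "(\<lambda>x. f x * g (2 * x - 1)) absolutely_integrable_on {1/2..1}"
    by (rule absolutely_integrable_spike[OF fg2 neg]) (auto simp: intermittent_map_def)
  have int2: "integral {1/2..1} (\<lambda>x. f x * g (2 * x - 1)) = integral {1/2..1} (\<lambda>x. f x * g (?T x))"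
    by (rule integral_spike[OF neg]) (auto simp: intermittent_map_def)
  let ?F1 = "\<lambda>x. f (left_inv b x) / ?D (left_inv b x) * g x"
  let ?F2 = "\<lambda>x. f ((x + 1) / 2) / 2 * g x"
  have "(\<lambda>x. \<bar>?D x\<bar> * ?F1 (?T x)) absolutely_integrable_on {0..1/2} \<and>
      integral {0..1/2} (\<lambda>x. \<bar>?D x\<bar> * ?F1 (?T x)) = integral {0..1/2} (\<lambda>x. f x * g (?T x))"
  proof -
    have "\<bar>?D x\<bar> * ?F1 (?T x) = f x * g (?T x)" if "x \<in> {0..1/2}" for x
      using D[of x] that by (simp add: left_inv_map[OF b])
    then show ?thesis
      using fg1 set_integrable_cong[OF refl refl, of "{0..1/2}" "\<lambda>x. \<bar>?D x\<bar> * ?F1 (?T x)" "\<lambda>x. f x * g (?T x)"]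
        integral_cong[of "{0..1/2}" "\<lambda>x. \<bar>?D x\<bar> * ?F1 (?T x)" "\<lambda>x. f x * g (?T x)"] by blast
  qed
  then have F1: "?F1 absolutely_integrable_on {0..1} \<and>
      integral {0..1} ?F1 = integral {0..1/2} (\<lambda>x. f x * g (?T x))"
    using has_absolute_integral_change_of_variables_1'[of "{0..1/2}" ?T ?D ?F1]
      intermittent_map_deriv[OF b] intermittent_map_inj[OF b] intermittent_map_image[OF b] by auto
  have im: "(\<lambda>x. 2 * x - 1) ` {1/2..1::real} = {0..1}"
  proof (intro equalityI subsetI)
    fix y :: real assume "y \<in> {0..1}"
    then show "y \<in> (\<lambda>x. 2 * x - 1) ` {1/2..1}" by (intro image_eqI[of _ _ "(y+1)/2"]) (auto simp: field_simps)
  qed auto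
  have der: "((\<lambda>x. 2 * x - 1) has_field_derivative 2) (at x within {1/2..1})" for x :: real
    by (auto intro!: derivative_eq_intros)
  have inj: "inj_on (\<lambda>x. 2 * x - 1) {1/2..1::real}" by (auto intro!: inj_onI)
  have F2: "?F2 absolutely_integrable_on {0..1} \<and>
      integral {0..1} ?F2 = integral {1/2..1} (\<lambda>x. f x * g (2 * x - 1))"
    using has_absolute_integral_change_of_variables_1'[of "{1/2..1}" "\<lambda>x. 2 * x - 1" "\<lambda>_. 2" ?F2]
      fg2' im der inj by auto
  have eq: "(\<lambda>x. transfer b f x * g x) = (\<lambda>x. ?F1 x + ?F2 x)"
    by (auto simp: transfer_def fun_eq_iff algebra_simps)
  show ?th1 unfolding eq using F1 F2 by (intro set_integral_add) auto
  have "integral {0..1} (\<lambda>x. ?F1 x + ?F2 x) = integral {0..1} ?F1 + integral {0..1} ?F2"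
    using F1 F2 by (intro integral_add) (auto intro: set_lebesgue_integral_eq_integral)
  also have "\<dots> = integral {0..1} (\<lambda>x. f x * g (?T x))"
    using F1 F2 int2 Henstock_Kurzweil_Integration.integral_combine[of 0 "1/2" 1 "\<lambda>x. f x * g (?T x)"] fg
    by (auto dest: set_lebesgue_integral_eq_integral)
  finally show ?th2 unfolding eq .
qed

text \<open>Both inverse branches increase, and the left branch is convex, so its derivative in the
  denominator increases too. Nonnegativity of f allows numerator and denominator to be compared
  together.\<close>

lemma transfer_antimono:
  assumes b: "0 < b" and f: "antimono_on {0<..1} f" "\<And>x. x \<in> {0<..1} \<Longrightarrow> 0 \<le> f x"
  shows "antimono_on {0<..1} (transfer b f)"
proof (rule monotone_onI)
  fix x y :: real assume xy: "x \<in> {0<..1}" "y \<in> {0<..1}" "x \<le> y"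
  have l: "left_inv b x \<le> left_inv b y" "0 < left_inv b x" "left_inv b y \<le> 1/2"
    using xy left_inv_mono[OF b, of x y] left_inv_pos[OF b, of x] left_inv_range[OF b, of y] by auto
  have "f (left_inv b y) \<le> f (left_inv b x)" "f ((y+1)/2) \<le> f ((x+1)/2)"
    using xy l by (auto intro!: monotone_onD[OF f(1)])
  moreover have "(2 * left_inv b x) powr b \<le> (2 * left_inv b y) powr b"
    using l b by (intro powr_mono2) auto
  ultimately show "transfer b f y \<le> transfer b f x"
    unfolding transfer_def using l b f(2)[of "left_inv b x"]
    by (intro add_mono divide_right_mono frac_le) (auto intro!: add_pos_nonneg)
qed

lemma transfer_nonneg:
  assumes b: "0 < b" and f: "\<And>x. x \<in> {0<..1} \<Longrightarrow> 0 \<le> f x" and x: "x \<in> {0<..1}"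
  shows "0 \<le> transfer b f x"
  using left_inv_pos[OF b x] left_inv_range[OF b, of x] x b f[of "left_inv b x"] f[of "(x+1)/2"]
  unfolding transfer_def by (auto intro!: add_nonneg_nonneg divide_nonneg_nonneg)

lemma transfer_decr:
  assumes "0 < b" "decr_density f" shows "decr_density (transfer b f)"
  using assms transfer_duality(1)[OF assms(1), of f "\<lambda>_. 1" 1] transfer_antimono transfer_nonneg
  unfolding decr_density_def by auto

lemma transfer_mass:
  assumes "0 < b" "f absolutely_integrable_on {0..1}"
  shows "integral {0..1} (transfer b f) = integral {0..1} f"
  using transfer_duality(2)[OF assms, of "\<lambda>_. 1" 1] by auto

lemma integral_mult_indicator_real:
  fixes f :: "real \<Rightarrow> real"
  assumes "0 \<le> s" "t \<le> 1"
  shows "integral {0..1} (\<lambda>x. f x * indicator {s..t} x) = integral {s..t} f"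
proof -
  have "integral {0..1} (\<lambda>x. f x * indicator {s..t} x) = integral {0..1} (\<lambda>x. if x \<in> {s..t} then f x else 0)"
    by (intro integral_cong) (auto simp: indicator_def)
  also have "\<dots> = integral ({s..t} \<inter> {0..1}) f" by (simp only: integral_restrict_Int)
  also have "{s..t} \<inter> {0..1} = {s..t}" using assms by auto
  finally show ?thesis .
qed

text \<open>Duality with the indicator of [0, t]: up to a null set, its preimage is [0, y] under the
  left branch and [1/2, (t+1)/2] under the right one.\<close>

lemma transfer_initial_mass:
  assumes b: "0 < b" and f: "f absolutely_integrable_on {0..1}" and t: "t \<in> {0..1}"
  shows "integral {0..t} (transfer b f) = integral {0..left_inv b t} f + integral {1/2..(t+1)/2} f"
proof -
  let ?y = "left_inv b t"
  have y: "0 \<le> ?y" "?y \<le> 1/2" using left_inv_range[OF b t] by auto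
  have "integral {0..t} (transfer b f) = integral {0..1} (\<lambda>x. transfer b f x * indicator {0..t} x)"
    using integral_mult_indicator_real[of 0 t "transfer b f"] t by simp
  also have "\<dots> = integral {0..1} (\<lambda>x. f x * indicator {0..t} (intermittent_map b x))"
    by (rule transfer_duality(2)[OF b f, of _ 1]) (auto simp: indicator_def)
  also have "\<dots> = integral {0..1} (\<lambda>x. f x * indicator {0..?y} x + f x * indicator {1/2..(t+1)/2} x)"
  proof (rule integral_spike[of "{1/2}"])
    fix x :: real assume x: "x \<in> {0..1} - {1/2}"
    show "f x * indicator {0..?y} x + f x * indicator {1/2..(t+1)/2} x = f x * indicator {0..t} (intermittent_map b x)"
    proof (cases "x < 1/2")
      case True
      have "0 \<le> intermittent_map b x" using x True intermittent_map_range[OF b, of x] by auto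
      then show ?thesis using intermittent_map_le_iff[OF b, of x t] x t True by (auto simp: indicator_def)
    next
      case False
      then show ?thesis using x y by (auto simp: indicator_def intermittent_map_def)
    qed
  qed auto
  also have "\<dots> = integral {0..1} (\<lambda>x. f x * indicator {0..?y} x) + integral {0..1} (\<lambda>x. f x * indicator {1/2..(t+1)/2} x)"
    using absolutely_integrable_mult_bounded[OF f, of "indicator {0..?y}" 1]
      absolutely_integrable_mult_bounded[OF f, of "indicator {1/2..(t+1)/2}" 1]
    by (intro integral_add) (auto intro!: set_lebesgue_integral_eq_integral simp: indicator_def)
  also have "\<dots> = integral {0..?y} f + integral {1/2..(t+1)/2} f"
    using y t by (simp add: integral_mult_indicator_real)
  finally show ?thesis .
qed

section \<open>Masses of decreasing densities\<close>

lemma decr_densityD: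
  assumes "decr_density f"
  shows "f absolutely_integrable_on {0..1}" "\<And>x. 0 < x \<Longrightarrow> x \<le> 1 \<Longrightarrow> 0 \<le> f x"
    "\<And>x y. 0 < x \<Longrightarrow> x \<le> y \<Longrightarrow> y \<le> 1 \<Longrightarrow> f y \<le> f x"
  using assms by (auto simp: decr_density_def monotone_on_def)

lemma decr_density_integrable:
  assumes "decr_density f" "0 \<le> s" "t \<le> 1"
  shows "f integrable_on {s..t}"
  using absolutely_integrable_on_subinterval[OF decr_densityD(1)[OF assms(1)], of s t] assms
    set_lebesgue_integral_eq_integral(1) by auto

lemma integral_lower_const:
  fixes f :: "real \<Rightarrow> real"
  assumes "f integrable_on {s..t}" "0 \<le> s" "s \<le> t" "\<And>x. 0 < x \<Longrightarrow> x \<in> {s..t} \<Longrightarrow> c \<le> f x"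
  shows "(t - s) * c \<le> integral {s..t} f"
proof -
  \<comment> \<open>The lower bound is known for positive arguments only; the value at 0 is replaced
    on a null set.\<close>
  let ?f = "\<lambda>x. if x = 0 then c else f x"
  have i: "?f integrable_on {s..t}"
    by (rule integrable_spike[OF assms(1), of "{0}"]) auto
  have "(t - s) * c = integral {s..t} (\<lambda>_. c)" using assms by simp
  also have "\<dots> \<le> integral {s..t} ?f" using assms i by (intro integral_le) auto
  also have "\<dots> = integral {s..t} f" by (rule integral_spike[of "{0}"]) auto
  finally show ?thesis .
qed

lemma integral_upper_const:
  fixes f :: "real \<Rightarrow> real"
  assumes "f integrable_on {s..t}" "0 \<le> s" "s \<le> t" "\<And>x. 0 < x \<Longrightarrow> x \<in> {s..t} \<Longrightarrow> f x \<le> c"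
  shows "integral {s..t} f \<le> (t - s) * c"
  using integral_lower_const[of "\<lambda>x. - f x" s t "- c"] assms by (auto simp: integrable_neg)

lemma decr_density_integral_nonneg:
  assumes "decr_density f" "0 \<le> s" "s \<le> t" "t \<le> 1"
  shows "0 \<le> integral {s..t} f"
  using integral_lower_const[of f s t 0] decr_density_integrable[of f s t] decr_densityD(2)[OF assms(1)] assms
  by auto

lemma decr_density_integral_split:
  assumes "decr_density f" "0 \<le> s" "s \<le> t" "t \<le> u" "u \<le> 1"
  shows "integral {s..u} f = integral {s..t} f + integral {t..u} f"
  using Henstock_Kurzweil_Integration.integral_combine[of s t u f] decr_density_integrable[of f s u] assms
  by simp

text \<open>Rests on ln (1 + u) >= u / (1 + u) >= u / 2. It serves twice, with u the relative
  displacement of a point under the left branch: with exponent 1 - \<alpha> for the mass near 0, and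
  with exponent \<alpha> for backward orbits.\<close>

lemma powr_one_plus_lower:
  fixes u s :: real
  assumes "0 \<le> u" "u \<le> 1" "0 < s"
  shows "1 + s / 2 * u \<le> (1 + u) powr s"
proof -
  have "u / 2 \<le> u / (1 + u)" using assms by (intro divide_left_mono) auto
  also have "\<dots> = 1 - 1 / (1 + u)" using assms by (simp add: field_simps)
  also have "\<dots> \<le> ln (1 + u)"
    using ln_le_minus_one[of "1 / (1 + u)"] assms by (simp add: ln_div)
  finally have "s * (u / 2) \<le> s * ln (1 + u)" using assms by (intro mult_left_mono) auto
  then have "1 + s / 2 * u \<le> 1 + s * ln (1 + u)" by simp
  also have "\<dots> \<le> exp (s * ln (1 + u))" by (rule exp_ge_add_one_self)
  finally show ?thesis using assms by (simp add: powr_def)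
qed

text \<open>The profile of a singularity of type \<open>x powr - \<alpha>\<close> at 0, stated for
  masses because these transform exactly under one step.\<close>

definition initial_bound :: "real \<Rightarrow> real \<Rightarrow> (real \<Rightarrow> real) \<Rightarrow> bool" where
  "initial_bound \<alpha> B f \<longleftrightarrow> (\<forall>t\<in>{0..1}. integral {0..t} f \<le> B * t powr (1 - \<alpha>))"

definition admissible :: "real \<Rightarrow> (nat \<Rightarrow> real) \<Rightarrow> bool" where
  "admissible \<alpha> a \<longleftrightarrow> (\<forall>j\<ge>1. 0 < a j \<and> a j \<le> \<alpha>)"

lemma admissible_shift: "admissible \<alpha> a \<Longrightarrow> admissible \<alpha> (\<lambda>j. a (j + k))"
  by (auto simp: admissible_def)

section \<open>Iterates along a parameter sequence\<close>

primrec push :: "(nat \<Rightarrow> real) \<Rightarrow> nat \<Rightarrow> (real \<Rightarrow> real) \<Rightarrow> real \<Rightarrow> real" where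
  "push a 0 f = f"
| "push a (Suc n) f = transfer (a (Suc n)) (push a n f)"

lemma push_add: "push a (k + j) f = push (\<lambda>i. a (i + k)) j (push a k f)"
  by (induction j) (auto simp: add_ac)

lemma push_Suc_first: "push a (Suc n) f = push (\<lambda>j. a (j + 1)) n (transfer (a 1) f)"
  using push_add[of a 1 n f] by simp

lemma seq_comp_add: "seq_comp a (k + j) x = seq_comp (\<lambda>i. a (i + k)) j (seq_comp a k x)"
  by (induction j) (auto simp: add_ac)

lemma seq_comp_borel [measurable]: "seq_comp a n \<in> borel_measurable borel"
  by (induction n) (auto simp: id_def intro!: measurable_comp[of _ _ borel])

lemma transfer_diff_const: "transfer b (\<lambda>x. f x - c * g x) x = transfer b f x - c * transfer b g x"
  by (simp add: transfer_def diff_divide_distrib distrib_left)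

lemma push_diff_const: "push a n (\<lambda>x. f x - c * g x) = (\<lambda>x. push a n f x - c * push a n g x)"
  by (induction n) (auto simp: transfer_diff_const)

text \<open>The point that n successive left branches carry to 1. The recursion peels off the first
  map, since the point lives at time 0, whereas \<open>push\<close> peels off the last one.\<close>

primrec left_preimage :: "nat \<Rightarrow> (nat \<Rightarrow> real) \<Rightarrow> real" where
  "left_preimage 0 a = 1"
| "left_preimage (Suc n) a = left_inv (a 1) (left_preimage n (\<lambda>j. a (j + 1)))"

lemma decr_density_const: "0 \<le> c \<Longrightarrow> decr_density (\<lambda>_. c)"
  by (auto simp: decr_density_def monotone_on_def)

lemma decr_density_minus_const:
  assumes "decr_density f" "\<And>x. x \<in> {0<..1} \<Longrightarrow> c \<le> f x"
  shows "decr_density (\<lambda>x. f x - c)"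
  using assms by (auto simp: decr_density_def monotone_on_def intro!: set_integral_diff)

text \<open>The right branch is dropped, and 3 bounds the derivative of the left one, as b <= 1 and
  its argument is at most 1/2.\<close>

lemma transfer_lower:
  assumes b: "0 < b" "b \<le> 1" and f: "decr_density f" and x: "x \<in> {0<..1}"
  shows "f (left_inv b x) / 3 \<le> transfer b f x"
proof -
  define y where "y = left_inv b x"
  have y: "0 < y" "y \<le> 1/2"
    using left_inv_range[OF b(1), of x] left_inv_pos[OF b(1), of x] x by (auto simp: y_def)
  have f0: "0 \<le> f y" "0 \<le> f ((x+1)/2)" using decr_densityD(2)[OF f] y x by auto
  have "(2 * y) powr b \<le> 1" using y b by (simp add: powr_le1)
  then have "(1 + b) * (2 * y) powr b \<le> 2 * 1" using b by (intro mult_mono) auto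
  then have D: "1 + (1 + b) * (2 * y) powr b \<le> 3" by simp
  have "0 < 1 + (1 + b) * (2 * y) powr b" using b by (intro add_pos_nonneg) auto
  with D f0 have "f y / 3 \<le> f y / (1 + (1 + b) * (2 * y) powr b)"
    by (intro divide_left_mono) auto
  then show ?thesis using f0 by (simp add: transfer_def y_def)
qed

section \<open>Mass near the neutral fixed point\<close>

context
  fixes \<alpha> :: real
  assumes \<alpha>: "0 < \<alpha>" "\<alpha> < 1"
begin

lemma admissible_first: "admissible \<alpha> a \<Longrightarrow> 0 < a (Suc n) \<and> a (Suc n) \<le> \<alpha>"
  by (auto simp: admissible_def)

text \<open>Moving from y to t = y (1 + u) multiplies the profile by (1 + u) powr (1 - \<alpha>), a
  relative gain of at least (1 - \<alpha>) / 2 * u. This gain pays for the mass entering [0, t] from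
  [1/2, 1], which is at most t times the total mass and hence of order y: from b <= \<alpha> follows
  y powr \<alpha> <= u, so y <= y powr (1 - \<alpha>) * u.\<close>

lemma transfer_initial_bound:
  assumes b: "0 < b" "b \<le> \<alpha>" and f: "decr_density f" "initial_bound \<alpha> B f"
    and B: "4 / (1 - \<alpha>) * integral {0..1} f \<le> B"
  shows "initial_bound \<alpha> B (transfer b f)"
  unfolding initial_bound_def
proof
  fix t :: real assume t: "t \<in> {0..1}"
  define y where "y = left_inv b t"
  define u where "u = (2 * y) powr b"
  let ?M = "integral {0..1} f"
  have y: "0 \<le> y" "y \<le> 1/2" "y * (1 + u) = t"
    using left_inv_range[OF b(1) t] left_inv_eq[OF b(1) t] by (auto simp: y_def u_def)
  have u: "0 \<le> u" "u \<le> 1" using y b by (auto simp: u_def powr_le1)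
  have M: "0 \<le> ?M" using decr_density_integral_nonneg[OF f(1)] by simp
  have B0: "0 \<le> B" using M \<alpha> by (intro order_trans[OF _ B]) auto
  have "(1/2 - 0) * f (1/2) \<le> integral {0..1/2} f"
    using decr_densityD(3)[OF f(1)] by (intro integral_lower_const decr_density_integrable[OF f(1)]) auto
  then have "f (1/2) / 2 \<le> ?M"
    using decr_density_integral_split[OF f(1), of 0 "1/2" 1]
      decr_density_integral_nonneg[OF f(1), of "1/2" 1] by simp
  then have "t * (f (1/2) / 2) \<le> t * ?M" using t by (intro mult_left_mono) auto
  moreover have "integral {1/2..(t+1)/2} f \<le> ((t+1)/2 - 1/2) * f (1/2)"
    using t decr_densityD(3)[OF f(1), of "1/2"] by (intro integral_upper_const decr_density_integrable[OF f(1)]) auto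
  ultimately have "integral {1/2..(t+1)/2} f \<le> t * ?M"
    by (simp add: diff_divide_distrib[symmetric])
  \<comment> \<open>The factor 4 / (1 - \<alpha>) in the hypothesis on B originates here: with t <=
    2 y the incoming mass must stay below B * (1 - \<alpha>) / 2 * y.\<close>
  also have "t * ?M \<le> B * ((1 - \<alpha>) / 2 * y)"
  proof -
    have "4 * ?M \<le> B * (1 - \<alpha>)" using B \<alpha> by (simp add: field_simps)
    moreover have "y * u \<le> y * 1" using y u by (intro mult_left_mono) auto
    then have "t \<le> 2 * y" unfolding y(3)[symmetric] distrib_left by simp
    ultimately have "t * (4 * ?M) \<le> (2 * y) * (B * (1 - \<alpha>))"
      using y M by (intro mult_mono[of t "2 * y" "4 * ?M"]) auto
    then show ?thesis by (simp add: algebra_simps)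
  qed
  also have "\<dots> \<le> B * ((1 - \<alpha>) / 2 * (y powr (1 - \<alpha>) * u))"
  proof -
    have "y \<le> y powr (1 - \<alpha>) * u"
    proof (cases "y = 0")
      case False
      then have "y = y powr (1 - \<alpha>) * y powr \<alpha>" using y(1) by (simp flip: powr_add)
      moreover have "y powr \<alpha> \<le> (2 * y) powr \<alpha>" using y(1) \<alpha> by (intro powr_mono2) auto
      moreover have "(2 * y) powr \<alpha> \<le> u" unfolding u_def using y(1,2) b by (intro powr_mono') auto
      ultimately show ?thesis
        using mult_left_mono[of "y powr \<alpha>" u "y powr (1 - \<alpha>)"] by simp
    qed auto
    then show ?thesis using B0 \<alpha> by (intro mult_left_mono) auto
  qed
  finally have "integral {1/2..(t+1)/2} f \<le> B * ((1 - \<alpha>) / 2 * (y powr (1 - \<alpha>) * u))" .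
  moreover have "integral {0..y} f \<le> B * y powr (1 - \<alpha>)"
    using f(2) y(1,2) unfolding initial_bound_def by auto
  ultimately have "integral {0..t} (transfer b f) \<le> B * y powr (1 - \<alpha>) + B * ((1 - \<alpha>) / 2 * (y powr (1 - \<alpha>) * u))"
    using transfer_initial_mass[OF b(1) decr_densityD(1)[OF f(1)] t] unfolding y_def[symmetric] by linarith
  also have "\<dots> = B * (y powr (1 - \<alpha>) * (1 + (1 - \<alpha>) / 2 * u))" by (simp add: algebra_simps)
  also have "\<dots> \<le> B * (y powr (1 - \<alpha>) * (1 + u) powr (1 - \<alpha>))"
    using powr_one_plus_lower[of u "1 - \<alpha>"] u \<alpha> B0 by (intro mult_left_mono) auto
  also have "\<dots> = B * t powr (1 - \<alpha>)"
    using y(1,2) u unfolding y(3)[symmetric] by (simp add: powr_mult)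
  finally show "integral {0..t} (transfer b f) \<le> B * t powr (1 - \<alpha>)" .
qed

lemma push_decr: "\<lbrakk>admissible \<alpha> a; decr_density f\<rbrakk> \<Longrightarrow> decr_density (push a n f)"
  by (induction n) (auto simp: transfer_decr admissible_first)

lemma push_mass:
  "\<lbrakk>admissible \<alpha> a; decr_density f\<rbrakk> \<Longrightarrow> integral {0..1} (push a n f) = integral {0..1} f"
  by (induction n) (auto simp: transfer_mass admissible_first push_decr decr_densityD)

lemma push_initial_bound:
  "\<lbrakk>admissible \<alpha> a; decr_density f; initial_bound \<alpha> B f; 4 / (1 - \<alpha>) * integral {0..1} f \<le> B\<rbrakk>
    \<Longrightarrow> initial_bound \<alpha> B (push a n f)"
  by (induction n) (auto intro!: transfer_initial_bound simp: admissible_first push_decr push_mass)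

lemma push_duality:
  assumes "admissible \<alpha> a" "decr_density f" "g \<in> borel_measurable borel" "\<And>x. \<bar>g x\<bar> \<le> L"
  shows "integral {0..1} (\<lambda>x. f x * g (seq_comp a n x)) = integral {0..1} (\<lambda>x. push a n f x * g x)"
  using assms(3,4)
proof (induction n arbitrary: g)
  case (Suc n)
  have "integral {0..1} (\<lambda>x. f x * g (intermittent_map (a (Suc n)) (seq_comp a n x)))
      = integral {0..1} (\<lambda>x. push a n f x * g (intermittent_map (a (Suc n)) x))"
    using Suc.prems by (intro Suc.IH) auto
  also have "\<dots> = integral {0..1} (\<lambda>x. push a (Suc n) f x * g x)"
    using transfer_duality(2)[of "a (Suc n)" "push a n f" g L] Suc.prems assms
    by (auto simp: admissible_first push_decr decr_densityD)
  finally show ?case by simp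
qed auto

section \<open>Backward orbits of 1 and uniform lower bounds\<close>

lemma left_preimage_range: "admissible \<alpha> a \<Longrightarrow> left_preimage n a \<in> {0<..1}"
proof (induction n arbitrary: a)
  case (Suc n)
  then show ?case
    using left_inv_pos[of "a 1" "left_preimage n (\<lambda>j. a (j + 1))"] admissible_first[of a 0]
      left_inv_range[of "a 1" "left_preimage n (\<lambda>j. a (j + 1))"] admissible_shift[of \<alpha> a 1]
    by fastforce
qed auto

text \<open>In the coordinate x powr (- \<alpha>), one backward step along a left branch adds at
  least \<alpha> / 2, whatever the parameter in (0, \<alpha>]. Thus the backward orbit is O(n powr
  (- 1 / \<alpha>)), uniformly in the sequence.\<close>

lemma left_preimage_powr: "admissible \<alpha> a \<Longrightarrow> 1 + \<alpha> / 2 * real n \<le> left_preimage n a powr (- \<alpha>)"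
proof (induction n arbitrary: a)
  case (Suc n)
  define e where "e = left_preimage n (\<lambda>j. a (j + 1))"
  define y where "y = left_inv (a 1) e"
  define u where "u = (2 * y) powr a 1"
  have a: "0 < a 1" "a 1 \<le> \<alpha>" using Suc.prems admissible_first[of a 0] by auto
  have ad: "admissible \<alpha> (\<lambda>j. a (j + 1))" using Suc.prems by (rule admissible_shift)
  have e: "0 < e" "e \<le> 1" using left_preimage_range[OF ad, of n] by (auto simp: e_def)
  have y: "0 < y" "y \<le> 1/2" "y * (1 + u) = e"
    using left_inv_range[OF a(1), of e] left_inv_pos[OF a(1), of e] left_inv_eq[OF a(1), of e] e
    by (auto simp: y_def u_def)
  have u: "0 \<le> u" "u \<le> 1" using y a by (auto simp: u_def powr_le1)
  \<comment> \<open>The aim is 1 <= e powr (- \<alpha>) * u, so that the factor 1 + \<alpha> / 2 * u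
    raises e powr (- \<alpha>) by at least \<alpha> / 2.\<close>
  have "1 = (2 * y) powr (- \<alpha>) * (2 * y) powr \<alpha>" using y by (simp add: powr_add[symmetric])
  also have "\<dots> \<le> e powr (- \<alpha>) * u"
  proof (rule mult_mono)
    have "y * u \<le> y * 1" using y u by (intro mult_left_mono) auto
    then have "e \<le> 2 * y" unfolding y(3)[symmetric] distrib_left by simp
    then show "(2 * y) powr (- \<alpha>) \<le> e powr (- \<alpha>)" using \<alpha> e by (intro powr_mono2') auto
    show "(2 * y) powr \<alpha> \<le> u" unfolding u_def using y a by (intro powr_mono') auto
  qed auto
  finally have "\<alpha> / 2 * 1 \<le> \<alpha> / 2 * (e powr (- \<alpha>) * u)" using \<alpha> by (intro mult_left_mono) auto
  moreover have "1 + \<alpha> / 2 * real n \<le> e powr (- \<alpha>)" unfolding e_def by (rule Suc.IH[OF ad])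
  ultimately have "1 + \<alpha> / 2 * real (Suc n) \<le> e powr (- \<alpha>) * (1 + \<alpha> / 2 * u)"
    by (simp add: algebra_simps add_divide_distrib)
  also have "\<dots> \<le> e powr (- \<alpha>) * (1 + u) powr \<alpha>"
    using powr_one_plus_lower[of u \<alpha>] u \<alpha> by (intro mult_left_mono) auto
  also have "\<dots> = y powr (- \<alpha>)"
    using y(1,2) u unfolding y(3)[symmetric] by (simp add: powr_mult powr_minus)
  finally show ?case by (simp add: y_def e_def)
qed auto

text \<open>Only the path through left branches is kept, at the price of a factor 3 per step. The
  value at 1 is the minimum of a decreasing density on (0, 1]. As the loss is exponential, the bound
  is applied to boundedly many steps.\<close>

lemma push_lower_naive:
  assumes "admissible \<alpha> a" "decr_density f"
  shows "(1/3) ^ n * f (left_preimage n a) \<le> push a n f 1"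
  using assms
proof (induction n arbitrary: a f)
  case (Suc n)
  define e where "e = left_preimage n (\<lambda>j. a (j + 1))"
  have a: "0 < a 1" "a 1 \<le> \<alpha>" using Suc.prems admissible_first[of a 0] by auto
  have ad: "admissible \<alpha> (\<lambda>j. a (j + 1))" using Suc.prems(1) by (rule admissible_shift)
  have e: "0 < e" "e \<le> 1" using left_preimage_range[OF ad, of n] by (auto simp: e_def)
  have "f (left_inv (a 1) e) / 3 \<le> transfer (a 1) f e"
    using transfer_lower[OF a(1) _ Suc.prems(2), of e] a(2) \<alpha> e by simp
  then have "(1/3) ^ n * (f (left_inv (a 1) e) / 3) \<le> (1/3) ^ n * transfer (a 1) f e" by (intro mult_left_mono) auto
  also have "\<dots> \<le> push (\<lambda>j. a (j + 1)) n (transfer (a 1) f) 1"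
    unfolding e_def using Suc.IH[OF ad] transfer_decr[OF a(1) Suc.prems(2)] by auto
  finally show ?case by (simp add: push_Suc_first e_def del: push.simps(2))
qed auto

text \<open>Uniform in n as well as in the sequence: all steps but the last N are summarised by the
  mass bound, which keeps half of the mass away from 0, and only the last N are paid for with
  factors 1/3.\<close>

lemma push_one_lower:
  obtains c where "0 < c" "c \<le> 1"
    "\<And>a n x. admissible \<alpha> a \<Longrightarrow> x \<in> {0<..1} \<Longrightarrow> c \<le> push a n (\<lambda>_. 1) x"
proof -
  define B where "B = 4 / (1 - \<alpha>)"
  \<comment> \<open>Solves \<open>B * d powr (1 - \<alpha>) = 1/2\<close>: a density of mass 1 with
    this bound has mass at least 1/2 on [d, 1], so its value at d is at least 1/2. N is then taken
    so large that N backward steps from 1 end at or to the left of d.\<close>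
  define d where "d = (2 * B) powr (- 1 / (1 - \<alpha>))"
  obtain N where N: "d powr (- \<alpha>) \<le> \<alpha> / 2 * real N"
    using real_arch_simple[of "d powr (- \<alpha>) / (\<alpha> / 2)"] \<alpha> by (auto simp: field_simps)
  have B: "4 \<le> B" using \<alpha> by (simp add: B_def field_simps)
  have d: "0 < d" "d \<le> 1"
    using B \<alpha> powr_mono[of "- 1 / (1 - \<alpha>)" 0 "2 * B"] by (auto simp: d_def)
  have "B * d powr (1 - \<alpha>) = B * (2 * B) powr (- 1)"
    using \<alpha> by (simp add: d_def powr_powr)
  then have Bd: "B * d powr (1 - \<alpha>) = 1/2"
    using B by (simp add: powr_minus)
  define c where "c = (1/3::real) ^ N / 2"
  have main: "c \<le> push a n (\<lambda>_. 1) 1" if a: "admissible \<alpha> a" for a n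
  proof (cases "n < N")
    case True
    have "c \<le> (1/3) ^ N" by (simp add: c_def)
    also have "\<dots> \<le> (1/3) ^ n" using True by (intro power_decreasing) auto
    also have "\<dots> \<le> push a n (\<lambda>_. 1) 1"
      using push_lower_naive[OF a decr_density_const[of 1], of n] by simp
    finally show ?thesis .
  next
    case False
    define k where "k = n - N"
    define h where "h = push a k (\<lambda>_. 1)"
    have ad: "admissible \<alpha> (\<lambda>j. a (j + k))" using a by (rule admissible_shift)
    have h: "decr_density h" "integral {0..1} h = 1"
      using push_decr[OF a decr_density_const[of 1]] push_mass[OF a decr_density_const[of 1]]
      by (auto simp: h_def)
    have "initial_bound \<alpha> B (\<lambda>_. 1)"
      unfolding initial_bound_def
    proof
      fix t :: real assume t: "t \<in> {0..1}"
      have "t powr 1 \<le> t powr (1 - \<alpha>)" using t \<alpha> by (intro powr_mono') auto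
      also have "\<dots> \<le> B * t powr (1 - \<alpha>)" using B mult_right_mono[of 1 B "t powr (1 - \<alpha>)"] by simp
      finally show "integral {0..t} (\<lambda>_. 1) \<le> B * t powr (1 - \<alpha>)" using t by simp
    qed
    then have "initial_bound \<alpha> B h"
      unfolding h_def by (intro push_initial_bound a decr_density_const) (auto simp: B_def)
    then have "integral {0..d} h \<le> B * d powr (1 - \<alpha>)" using d unfolding initial_bound_def by auto
    then have "integral {0..d} h \<le> 1/2" using Bd by simp
    then have "1/2 \<le> integral {d..1} h"
      using decr_density_integral_split[OF h(1), of 0 d 1] d h(2) by auto
    also have "\<dots> \<le> (1 - d) * h d"
      using d decr_densityD(3)[OF h(1), of d] by (intro integral_upper_const decr_density_integrable[OF h(1)]) auto
    also have "\<dots> \<le> h d" using d decr_densityD(2)[OF h(1), of d] by (simp add: algebra_simps)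
    also have "h d \<le> h (left_preimage N (\<lambda>j. a (j + k)))"
    proof (rule decr_densityD(3)[OF h(1)])
      have "d powr (- \<alpha>) \<le> left_preimage N (\<lambda>j. a (j + k)) powr (- \<alpha>)"
        using left_preimage_powr[OF ad, of N] N by simp
      then show "left_preimage N (\<lambda>j. a (j + k)) \<le> d"
        using left_preimage_range[OF ad, of N] d \<alpha>
          powr_less_mono2_neg[of "- \<alpha>" d "left_preimage N (\<lambda>j. a (j + k))"] by force
    qed (use left_preimage_range[OF ad, of N] d in auto)
    finally have "(1/3) ^ N * (1/2) \<le> (1/3) ^ N * h (left_preimage N (\<lambda>j. a (j + k)))"
      by (intro mult_left_mono) auto
    also have "\<dots> \<le> push (\<lambda>j. a (j + k)) N h 1" by (rule push_lower_naive[OF ad h(1)])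
    also have "\<dots> = push a n (\<lambda>_. 1) 1"
      using False push_add[of a k N "\<lambda>_. 1"] by (simp add: h_def k_def)
    finally show ?thesis by (simp add: c_def)
  qed
  show thesis
  proof (rule that[of c])
    show "0 < c" by (simp add: c_def)
    show "c \<le> 1" using power_le_one[of "1/3::real" N] by (simp add: c_def)
    fix a n and x :: real assume a: "admissible \<alpha> a" and x: "x \<in> {0<..1}"
    have "push a n (\<lambda>_. 1) 1 \<le> push a n (\<lambda>_. 1) x"
      using decr_densityD(3)[OF push_decr[OF a decr_density_const[of 1], of n], of x 1] x by simp
    with main[OF a, of n] show "c \<le> push a n (\<lambda>_. 1) x" by simp
  qed
qed

end

section \<open>Coupling and loss of memory\<close>

lemma initial_bound_mono:
  assumes "initial_bound \<alpha> B f" "\<And>t. t \<in> {0..1} \<Longrightarrow> integral {0..t} g \<le> integral {0..t} f"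
  shows "initial_bound \<alpha> B g"
  using assms unfolding initial_bound_def by (meson order_trans)

lemma integral_minus_const:
  fixes f :: "real \<Rightarrow> real"
  assumes "f integrable_on {0..t}" "0 \<le> t"
  shows "integral {0..t} (\<lambda>x. f x - c) = integral {0..t} f - t * c"
  using assms by (subst integral_diff) auto

lemma integral_mult_le:
  fixes r g :: "real \<Rightarrow> real"
  assumes r: "decr_density r" and g: "g \<in> borel_measurable borel" "\<And>x. \<bar>g x\<bar> \<le> L"
  shows "\<bar>integral {0..1} (\<lambda>x. r x * g x)\<bar> \<le> L * integral {0..1} r"
proof -
  let ?r = "\<lambda>x. if x = 0 then 0 else r x"
  have i: "(\<lambda>x. r x * g x) integrable_on {0..1}"
    using absolutely_integrable_mult_bounded[OF decr_densityD(1)[OF r] _ g(1), of L] g(2)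
      set_lebesgue_integral_eq_integral(1) by auto
  have "norm (integral {0..1} (\<lambda>x. r x * g x)) \<le> integral {0..1} (\<lambda>x. L * ?r x)"
  proof (subst integral_spike[of "{0}" _ "\<lambda>x. ?r x * g x"], goal_cases)
    case 3
    show ?case
    proof (rule integral_norm_bound_integral)
      show "(\<lambda>x. ?r x * g x) integrable_on {0..1}" by (rule integrable_spike[OF i, of "{0}"]) auto
      show "(\<lambda>x. L * ?r x) integrable_on {0..1}"
        by (intro integrable_on_mult_right integrable_spike[OF decr_density_integrable[OF r], of 0 1 "{0}"]) auto
      show "norm (?r x * g x) \<le> L * ?r x" if "x \<in> {0..1}" for x
        using that decr_densityD(2)[OF r, of x] mult_left_mono[OF g(2)[of x], of "r x"]
        by (auto simp: abs_mult mult.commute)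
    qed
  qed auto
  also have "\<dots> = L * integral {0..1} ?r" by simp
  also have "integral {0..1} ?r = integral {0..1} r" by (rule integral_spike[of "{0}"]) auto
  finally show ?thesis by simp
qed

context
  fixes \<alpha> :: real
  assumes \<alpha>: "0 < \<alpha>" "\<alpha> < 1"
begin

text \<open>One step spreads a constant fraction of the mass on \<open>[1/2, 1]\<close> uniformly over the interval;
  the rest is again decreasing. Mass starting to the right of \<open>left_preimage n a\<close> reaches
  \<open>[1/2, 1]\<close> within \<open>n\<close> steps.\<close>

lemma push_lower:
  assumes c: "0 < c" "\<And>a n x. admissible \<alpha> a \<Longrightarrow> x \<in> {0<..1} \<Longrightarrow> c \<le> push a n (\<lambda>_. 1) x"
    and a: "admissible \<alpha> a" and f: "decr_density f" and x: "x \<in> {0<..1}"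
  shows "2/5 * c * (integral {0..1} f - integral {0..left_preimage n a} f) \<le> push a n f x"
  using a f
proof (induction n arbitrary: a f)
  case 0
  then show ?case using decr_densityD(2)[OF 0(2), of x] x by simp
next
  case (Suc n)
  define a' where "a' = (\<lambda>j. a (j + 1))"
  define e where "e = left_preimage n a'"
  define m0 where "m0 = integral {1/2..1} f"
  define Tf where "Tf = transfer (a 1) f"
  \<comment> \<open>What remains above a uniform layer of height 2/3 m0. The height combines f (1/2)
    >= 2 m0, from monotonicity, with the factor 1/3 of one step.\<close>
  define r where "r = (\<lambda>x. Tf x - 2/3 * m0 * 1)"
  have a: "0 < a 1" "a 1 \<le> \<alpha>" using admissible_first[OF \<alpha> Suc.prems(1), of 0] by auto
  have ad: "admissible \<alpha> a'" unfolding a'_def using Suc.prems(1) by (rule admissible_shift)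
  have e: "0 < e" "e \<le> 1" using left_preimage_range[OF \<alpha> ad, of n] by (auto simp: e_def)
  note f = Suc.prems(2)
  have Tf: "decr_density Tf" unfolding Tf_def using a f by (intro transfer_decr)
  have m0: "0 \<le> m0" unfolding m0_def using f by (intro decr_density_integral_nonneg) auto
  have "m0 \<le> (1 - 1/2) * f (1/2)"
    unfolding m0_def using decr_densityD(3)[OF f]
    by (intro integral_upper_const decr_density_integrable[OF f]) auto
  then have m0f: "2/3 * m0 \<le> f (1/2) / 3" by simp
  have Tf_low: "2/3 * m0 \<le> Tf z" if z: "z \<in> {0<..1}" for z
  proof -
    have "f (1/2) \<le> f (left_inv (a 1) z)"
      using decr_densityD(3)[OF f, of "left_inv (a 1) z" "1/2"] left_inv_pos[OF a(1) z]
        left_inv_range[OF a(1), of z] z by auto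
    with m0f transfer_lower[OF a(1) _ f z] a \<alpha> show ?thesis unfolding Tf_def by simp
  qed
  have r: "decr_density r" unfolding r_def using decr_density_minus_const[OF Tf Tf_low] by simp
  have r1: "integral {0..1} r = integral {0..1} f - 2/3 * m0"
    using integral_minus_const[OF decr_density_integrable[OF Tf, of 0 1], of "2/3 * m0"]
      transfer_mass[OF a(1) decr_densityD(1)[OF f]] by (simp add: r_def Tf_def)
  \<comment> \<open>In the worst case the right branch sends all of m0 into [0, e]; this loss is
    accepted.\<close>
  have "integral {0..e} r \<le> integral {0..e} Tf"
    using integral_minus_const[OF decr_density_integrable[OF Tf, of 0 e], of "2/3 * m0"] e m0
    by (simp add: r_def)
  also have "\<dots> = integral {0..left_inv (a 1) e} f + integral {1/2..(e+1)/2} f"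
    unfolding Tf_def using transfer_initial_mass[OF a(1) decr_densityD(1)[OF f]] e by simp
  also have "integral {1/2..(e+1)/2} f \<le> m0"
    using decr_density_integral_split[OF f, of "1/2" "(e+1)/2" 1]
      decr_density_integral_nonneg[OF f, of "(e+1)/2" 1] e by (simp add: m0_def)
  finally have r2: "integral {0..e} r \<le> integral {0..left_inv (a 1) e} f + m0" by simp
  \<comment> \<open>Origin of 2/5: for r, the total mass has dropped by 2/3 m0 and the trapped mass
    may have grown by m0, altogether 5/3 m0, while the removed layer later contributes 2/3 m0 c.
    These balance exactly for the factor (2/3) / (5/3).\<close>
  have "2/5 * c * (integral {0..1} f - integral {0..left_inv (a 1) e} f)
      = 2/5 * c * ((integral {0..1} f - 2/3 * m0) - (integral {0..left_inv (a 1) e} f + m0)) + 2/3 * m0 * c"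
    by (simp add: algebra_simps)
  also have "\<dots> \<le> 2/5 * c * (integral {0..1} r - integral {0..e} r) + 2/3 * m0 * c"
    using r1 r2 c(1) m0 by (intro add_mono mult_left_mono) auto
  also have "\<dots> \<le> push a' n r x + 2/3 * m0 * push a' n (\<lambda>_. 1) x"
    using Suc.IH[OF ad r] c(2)[OF ad x, of n] m0 unfolding e_def
    by (intro add_mono mult_left_mono) auto
  also have "\<dots> = push a' n Tf x" unfolding r_def push_diff_const by simp
  also have "\<dots> = push a (Suc n) f x"
    unfolding a'_def Tf_def by (simp only: push_Suc_first)
  finally show ?case by (simp add: e_def a'_def del: push.simps)
qed

text \<open>Translates the position of the backward orbit into trapped mass, using (1 - \<alpha>) /
  \<alpha> = 1 / \<alpha> - 1.\<close>

lemma left_preimage_bound: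
  assumes "admissible \<alpha> a" "n \<ge> 1"
  shows "left_preimage n a powr (1 - \<alpha>) \<le> (\<alpha> / 2) powr - (1 / \<alpha> - 1) * real n powr - (1 / \<alpha> - 1)"
proof -
  let ?l = "left_preimage n a"
  have "?l powr (1 - \<alpha>) = (?l powr - \<alpha>) powr - (1 / \<alpha> - 1)"
    using \<alpha> by (simp add: powr_powr algebra_simps)
  also have "\<dots> \<le> (\<alpha> / 2 * real n) powr - (1 / \<alpha> - 1)"
    using left_preimage_powr[OF \<alpha> assms(1), of n] assms(2) \<alpha> by (intro powr_mono2') auto
  also have "\<dots> = (\<alpha> / 2) powr - (1 / \<alpha> - 1) * real n powr - (1 / \<alpha> - 1)"
    using \<alpha> by (subst powr_mult) auto
  finally show ?thesis .
qed

text \<open>The same constant is subtracted from both densities and cancels in their difference, so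
  only the common remaining mass matters. A block of N steps turns M into at most (1 - \<kappa>) M +
  \<kappa> D N^(-s). If M <= Q n'^(-s) at time n' = n - N with N about n / m, the bound reproduces
  itself at time n, provided that n' / n is close enough to 1 and Q is large compared with D
  m^s.\<close>

lemma coupling:
  assumes B: "0 \<le> B"
  obtains Q where "0 \<le> Q" "\<And>a f1 f2 n. \<lbrakk>admissible \<alpha> a; n \<ge> 1;
      decr_density f1; initial_bound \<alpha> B f1; decr_density f2; initial_bound \<alpha> B f2;
      integral {0..1} f1 = integral {0..1} f2; 4 / (1 - \<alpha>) * integral {0..1} f1 \<le> B\<rbrakk> \<Longrightarrow>
    \<exists>r1 r2. decr_density r1 \<and> decr_density r2 \<and> integral {0..1} r1 = integral {0..1} r2 \<and>
      integral {0..1} r1 \<le> Q * real n powr - (1 / \<alpha> - 1) \<and>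
      (\<forall>x. push a n f1 x - push a n f2 x = r1 x - r2 x)"
proof -
  define s where "s = 1 / \<alpha> - 1"
  have s: "0 < s" using \<alpha> by (simp add: s_def)
  obtain c where c: "0 < c" "c \<le> 1" "\<And>a n x. admissible \<alpha> a \<Longrightarrow> x \<in> {0<..1} \<Longrightarrow> c \<le> push a n (\<lambda>_. 1) x"
    using push_one_lower[OF \<alpha>] by blast
  define \<kappa> where "\<kappa> = 2/5 * c"
  have \<kappa>: "0 < \<kappa>" "\<kappa> < 1" using c by (auto simp: \<kappa>_def)
  \<comment> \<open>m is chosen so that passing from n' to n costs less than half of the gain
    \<kappa>: the ratio n' / n is at least 1 - 1 / m.\<close>
  have "((\<lambda>m. (1 - \<kappa>) * (1 - 1 / real m) powr (- s)) \<longlongrightarrow> (1 - \<kappa>) * (1 - 0) powr (- s)) sequentially"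
    by (intro tendsto_intros lim_1_over_n) auto
  moreover have "(1 - \<kappa>) * (1 - 0) powr (- s) < 1 - \<kappa> / 2" using \<kappa> by simp
  ultimately have "eventually (\<lambda>m. (1 - \<kappa>) * (1 - 1 / real m) powr (- s) < 1 - \<kappa> / 2) sequentially"
    by (rule order_tendstoD)
  then have "eventually (\<lambda>m. (1 - \<kappa>) * (1 - 1 / real m) powr (- s) < 1 - \<kappa> / 2 \<and> m \<ge> 2) sequentially"
    using eventually_ge_at_top by (rule eventually_conj)
  then have "\<exists>m. (1 - \<kappa>) * (1 - 1 / real m) powr (- s) < 1 - \<kappa> / 2 \<and> m \<ge> 2"
    by (rule eventually_happens'[OF sequentially_bot])
  then obtain m where m: "(1 - \<kappa>) * (1 - 1 / real m) powr (- s) < 1 - \<kappa> / 2" "m \<ge> 2" by blast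
  define D where "D = B * (\<alpha> / 2) powr (- s)"
  \<comment> \<open>The first summand lets the trapped mass, with N >= n / (2 m), be absorbed as
    \<kappa> / 2 times the target; the second covers times n < m, where nothing is subtracted and
    the mass is at most B.\<close>
  define Q where "Q = 2 * D * (2 * real m) powr s + B * real m powr s"
  have D: "0 \<le> D" using B by (simp add: D_def)
  have Q: "0 \<le> Q" "B * real m powr s \<le> Q" "2 * D * (2 * real m) powr s \<le> Q" using D B by (auto simp: Q_def)
  \<comment> \<open>Stronger than the goal: the remainders satisfy the bounds with the same B, so
    that the next block can start from them.\<close>
  have main: "\<exists>r1 r2. decr_density r1 \<and> decr_density r2 \<and> initial_bound \<alpha> B r1 \<and> initial_bound \<alpha> B r2 \<and>
      integral {0..1} r1 = integral {0..1} r2 \<and> 4 / (1 - \<alpha>) * integral {0..1} r1 \<le> B \<and>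
      integral {0..1} r1 \<le> Q * real n powr (- s) \<and>
      (\<forall>x. push a n f1 x - push a n f2 x = r1 x - r2 x)"
    if a: "admissible \<alpha> a" and n: "n \<ge> 1"
      and f1: "decr_density f1" "initial_bound \<alpha> B f1" and f2: "decr_density f2" "initial_bound \<alpha> B f2"
      and M: "integral {0..1} f1 = integral {0..1} f2" "4 / (1 - \<alpha>) * integral {0..1} f1 \<le> B"
    for a f1 f2 n
    using n
  proof (induction n rule: less_induct)
    case (less n)
    show ?case
    proof (cases "n < m")
      case True
      have "integral {0..1} f1 \<le> 4 / (1 - \<alpha>) * integral {0..1} f1"
        using decr_density_integral_nonneg[OF f1(1), of 0 1] \<alpha> by (simp add: field_simps)
      also have "\<dots> \<le> B" by (rule M)
      also have "\<dots> = B * real m powr s * real m powr (- s)" using m by (simp add: powr_minus)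
      also have "\<dots> \<le> Q * real n powr (- s)"
        using Q(1,2) True less.prems s by (intro mult_mono powr_mono2') auto
      finally show ?thesis
        using f1 f2 M
        by (intro exI[of _ "push a n f1"] exI[of _ "push a n f2"])
          (simp add: push_decr[OF \<alpha> a] push_mass[OF \<alpha> a] push_initial_bound[OF \<alpha> a])
    next
      case False
      define N where "N = n div m"
      define n' where "n' = n - N"
      have nm: "m \<le> n" using False by simp
      then have N1: "1 \<le> N" using m unfolding N_def by (simp add: less_eq_div_iff_mult_less_eq)
      have "N \<le> n" by (simp add: N_def)
      then have n: "n = n' + N" by (simp add: n'_def)
      have "N * 2 \<le> n" unfolding N_def using m
        by (meson div_times_less_eq_dividend le_trans mult_le_mono2)
      then have n': "1 \<le> n'" "n' < n" using n N1 by auto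
      have "N * m \<le> n" by (simp add: N_def)
      then have "real N * real m \<le> real n" by (metis of_nat_le_iff of_nat_mult)
      then have n'_low: "real n * (1 - 1 / real m) \<le> real n'"
        using m n by (simp add: field_simps)
      have "n < m * (N + 1)" unfolding N_def using m dividend_less_times_div[of m n] by simp
      also have "\<dots> \<le> m * (2 * N)" using N1 by (intro mult_left_mono) auto
      finally have "real n \<le> real (m * (2 * N))" by (subst of_nat_le_iff) simp
      then have N_low: "real n / (2 * real m) \<le> real N"
        using m by (simp add: field_simps)
      obtain g1 g2 where g1: "decr_density g1" "initial_bound \<alpha> B g1"
        and g2: "decr_density g2" "initial_bound \<alpha> B g2"
        and g: "integral {0..1} g1 = integral {0..1} g2" "4 / (1 - \<alpha>) * integral {0..1} g1 \<le> B"
          "integral {0..1} g1 \<le> Q * real n' powr (- s)"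
        and gd: "\<And>x. push a n' f1 x - push a n' f2 x = g1 x - g2 x"
        using less.IH[OF n'(2,1)] by blast
      define a' where "a' = (\<lambda>i. a (i + n'))"
      have a': "admissible \<alpha> a'" unfolding a'_def using a by (rule admissible_shift)
      define M' where "M' = integral {0..1} g1"
      \<comment> \<open>The maximum with 0 covers blocks in which the trapped mass may exceed M';
        then nothing is subtracted. Since t is nonnegative, subtraction preserves the bound on
        initial masses.\<close>
      define t where "t = max 0 (\<kappa> * (M' - D * real N powr (- s)))"
      have low: "t \<le> push a' N h x" if h: "decr_density h" "initial_bound \<alpha> B h" "integral {0..1} h = M'"
        and x: "x \<in> {0<..1}" for h x
      proof -
        have "integral {0..left_preimage N a'} h \<le> B * left_preimage N a' powr (1 - \<alpha>)"
          using h(2) left_preimage_range[OF \<alpha> a', of N] unfolding initial_bound_def by auto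
        also have "\<dots> \<le> B * ((\<alpha> / 2) powr - s * real N powr - s)"
          unfolding s_def using left_preimage_bound[OF a' N1] B by (intro mult_left_mono) auto
        finally have "\<kappa> * (M' - D * real N powr (- s)) \<le> \<kappa> * (integral {0..1} h - integral {0..left_preimage N a'} h)"
          using \<kappa> h(3) by (intro mult_left_mono) (auto simp: D_def)
        also have "\<dots> \<le> push a' N h x"
          unfolding \<kappa>_def by (rule push_lower[OF c(1,3) a' h(1) x])
        finally show ?thesis
          using decr_densityD(2)[OF push_decr[OF \<alpha> a' h(1)], of x] x by (simp add: t_def)
      qed
      have t0: "0 \<le> t" by (simp add: t_def)
      have rem: "decr_density (\<lambda>x. push a' N h x - t)" "initial_bound \<alpha> B (\<lambda>x. push a' N h x - t)"
        "integral {0..1} (\<lambda>x. push a' N h x - t) = M' - t"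
        if h: "decr_density h" "initial_bound \<alpha> B h" "integral {0..1} h = M'" for h
      proof -
        have p: "decr_density (push a' N h)" by (rule push_decr[OF \<alpha> a' h(1)])
        show "decr_density (\<lambda>x. push a' N h x - t)" by (rule decr_density_minus_const[OF p low[OF h]])
        show "integral {0..1} (\<lambda>x. push a' N h x - t) = M' - t"
          using integral_minus_const[OF decr_density_integrable[OF p, of 0 1], of t]
            push_mass[OF \<alpha> a' h(1)] h(3) by simp
        show "initial_bound \<alpha> B (\<lambda>x. push a' N h x - t)"
        proof (rule initial_bound_mono)
          show "initial_bound \<alpha> B (push a' N h)"
            using push_initial_bound[OF \<alpha> a' h(1,2)] h(3) g(2) by (simp add: M'_def)
          show "integral {0..u} (\<lambda>x. push a' N h x - t) \<le> integral {0..u} (push a' N h)" if "u \<in> {0..1}" for u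
            using integral_minus_const[OF decr_density_integrable[OF p, of 0 u], of t] that t0 by simp
        qed
      qed
      have "M' - t \<le> (1 - \<kappa>) * M' + \<kappa> * (D * real N powr (- s))"
        by (simp add: t_def algebra_simps)
      also have "\<dots> \<le> (1 - \<kappa>) * (Q * (real n * (1 - 1 / real m)) powr (- s))
          + \<kappa> * (D * (real n / (2 * real m)) powr (- s))"
      proof -
        have "M' \<le> Q * (real n * (1 - 1 / real m)) powr (- s)"
        proof -
          have "real n' powr (- s) \<le> (real n * (1 - 1 / real m)) powr (- s)"
            using n'_low s m nm by (intro powr_mono2') auto
          then show ?thesis using g(3) Q(1) mult_left_mono unfolding M'_def by (meson order_trans)
        qed
        moreover have "real N powr (- s) \<le> (real n / (2 * real m)) powr (- s)"
          using N_low s m nm by (intro powr_mono2') auto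
        ultimately show ?thesis using \<kappa> D by (intro add_mono mult_left_mono) auto
      qed
      also have "\<dots> = ((1 - \<kappa>) * (1 - 1 / real m) powr (- s)) * (Q * real n powr (- s))
          + \<kappa> / 2 * ((2 * D * (2 * real m) powr s) * real n powr (- s))"
      proof -
        have "(real n * (1 - 1 / real m)) powr (- s) = real n powr (- s) * (1 - 1 / real m) powr (- s)"
          using m by (subst powr_mult) auto
        moreover have "(real n / (2 * real m)) powr (- s) = (2 * real m) powr s * real n powr (- s)"
          using m by (subst powr_divide) (auto simp: powr_minus field_simps)
        ultimately show ?thesis by simp
      qed
      also have "\<dots> \<le> (1 - \<kappa> / 2) * (Q * real n powr (- s)) + \<kappa> / 2 * (Q * real n powr (- s))"
        using m(1) Q \<kappa> by (intro add_mono mult_left_mono mult_right_mono) auto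
      also have "\<dots> = Q * real n powr (- s)" by (simp add: algebra_simps)
      finally have mass: "M' - t \<le> Q * real n powr (- s)" .
      have diff: "push a n f1 x - push a n f2 x = (push a' N g1 x - t) - (push a' N g2 x - t)" for x
      proof -
        have e: "(\<lambda>x. push a n' f1 x - 1 * push a n' f2 x) = (\<lambda>x. g1 x - 1 * g2 x)"
          using gd by auto
        have "push a n f1 x - push a n f2 x = push a' N (\<lambda>x. push a n' f1 x - 1 * push a n' f2 x) x"
          unfolding n push_add a'_def push_diff_const by simp
        also have "\<dots> = push a' N g1 x - push a' N g2 x"
          unfolding e push_diff_const by simp
        finally show ?thesis by simp
      qed
      have "4 / (1 - \<alpha>) * (M' - t) \<le> 4 / (1 - \<alpha>) * M'" using t0 \<alpha> by (intro mult_left_mono) auto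
      then have "4 / (1 - \<alpha>) * (M' - t) \<le> B" using g(2) by (simp add: M'_def)
      then show ?thesis
        using rem[OF g1] rem[OF g2] g(1) mass diff
        by (intro exI[of _ "\<lambda>x. push a' N g1 x - t"] exI[of _ "\<lambda>x. push a' N g2 x - t"])
          (simp add: M'_def)
    qed
  qed
  show thesis
    by (rule that[of Q]) (use Q(1) main in \<open>unfold s_def, blast+\<close>)
qed

text \<open>The coupling read through duality: the difference is the integral of (r1 - r2) g, and
  each remainder contributes its mass once, hence the factor 2 in front of Q.\<close>

lemma loss_of_memory:
  assumes B: "0 \<le> B"
  obtains Q where "0 \<le> Q" "\<And>a f1 f2 n g L. \<lbrakk>admissible \<alpha> a; n \<ge> 1;
      decr_density f1; initial_bound \<alpha> B f1; decr_density f2; initial_bound \<alpha> B f2;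
      integral {0..1} f1 = integral {0..1} f2; 4 / (1 - \<alpha>) * integral {0..1} f1 \<le> B;
      g \<in> borel_measurable borel; \<And>x. \<bar>g x\<bar> \<le> L\<rbrakk> \<Longrightarrow>
    \<bar>integral {0..1} (\<lambda>x. f1 x * g (seq_comp a n x)) - integral {0..1} (\<lambda>x. f2 x * g (seq_comp a n x))\<bar>
      \<le> L * (Q * real n powr - (1 / \<alpha> - 1))"
proof -
  obtain Q where Q: "0 \<le> Q" "\<And>a f1 f2 n. \<lbrakk>admissible \<alpha> a; n \<ge> 1;
      decr_density f1; initial_bound \<alpha> B f1; decr_density f2; initial_bound \<alpha> B f2;
      integral {0..1} f1 = integral {0..1} f2; 4 / (1 - \<alpha>) * integral {0..1} f1 \<le> B\<rbrakk> \<Longrightarrow>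
    \<exists>r1 r2. decr_density r1 \<and> decr_density r2 \<and> integral {0..1} r1 = integral {0..1} r2 \<and>
      integral {0..1} r1 \<le> Q * real n powr - (1 / \<alpha> - 1) \<and>
      (\<forall>x. push a n f1 x - push a n f2 x = r1 x - r2 x)"
    using coupling[OF B] by blast
  show thesis
  proof (rule that[of "2 * Q"])
    fix a f1 f2 n and g :: "real \<Rightarrow> real" and L
    assume a: "admissible \<alpha> a" and n: "n \<ge> (1::nat)"
      and f1: "decr_density f1" "initial_bound \<alpha> B f1" and f2: "decr_density f2" "initial_bound \<alpha> B f2"
      and M: "integral {0..1} f1 = integral {0..1} f2" "4 / (1 - \<alpha>) * integral {0..1} f1 \<le> B"
      and g: "g \<in> borel_measurable borel" "\<And>x. \<bar>g x\<bar> \<le> L"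
    obtain r1 r2 where r: "decr_density r1" "decr_density r2" "integral {0..1} r1 = integral {0..1} r2"
      "integral {0..1} r1 \<le> Q * real n powr - (1 / \<alpha> - 1)"
      and d: "\<And>x. push a n f1 x - push a n f2 x = r1 x - r2 x"
      using Q(2)[OF a n f1 f2 M] by blast
    have L: "0 \<le> L" using g(2)[of 0] by linarith
    have i: "(\<lambda>x. h x * g x) integrable_on {0..1}" if "decr_density h" for h
      using absolutely_integrable_mult_bounded[OF decr_densityD(1)[OF that] _ g(1), of L] g(2)
        set_lebesgue_integral_eq_integral(1) by auto
    have "integral {0..1} (\<lambda>x. f1 x * g (seq_comp a n x)) - integral {0..1} (\<lambda>x. f2 x * g (seq_comp a n x))
      = integral {0..1} (\<lambda>x. push a n f1 x * g x) - integral {0..1} (\<lambda>x. push a n f2 x * g x)"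
      using push_duality[OF \<alpha> a f1(1) g] push_duality[OF \<alpha> a f2(1) g] by simp
    also have "\<dots> = integral {0..1} (\<lambda>x. push a n f1 x * g x - push a n f2 x * g x)"
      using push_decr[OF \<alpha> a] f1 f2 i by (intro integral_diff[symmetric]) auto
    also have "\<dots> = integral {0..1} (\<lambda>x. r1 x * g x - r2 x * g x)"
      using d by (simp flip: left_diff_distrib)
    also have "\<dots> = integral {0..1} (\<lambda>x. r1 x * g x) - integral {0..1} (\<lambda>x. r2 x * g x)"
      using r i by (intro integral_diff) auto
    finally have "\<bar>integral {0..1} (\<lambda>x. f1 x * g (seq_comp a n x)) - integral {0..1} (\<lambda>x. f2 x * g (seq_comp a n x))\<bar>
      \<le> L * integral {0..1} r1 + L * integral {0..1} r2"
      using integral_mult_le[OF r(1) g] integral_mult_le[OF r(2) g] by linarith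
    also have "\<dots> \<le> L * (2 * Q * real n powr - (1 / \<alpha> - 1))"
      using mult_left_mono[OF r(4) L] r(3) by (simp add: algebra_simps)
    finally show "\<bar>integral {0..1} (\<lambda>x. f1 x * g (seq_comp a n x)) - integral {0..1} (\<lambda>x. f2 x * g (seq_comp a n x))\<bar>
      \<le> L * (2 * Q * real n powr - (1 / \<alpha> - 1))" .
  qed (use Q in auto)
qed

end

section \<open>A moment inequality\<close>

definition dabs_powr :: "real \<Rightarrow> real \<Rightarrow> real" where
  "dabs_powr r u = r * sgn u * \<bar>u\<bar> powr (r - 1)"

lemma dabs_powr_borel [measurable]: "dabs_powr r \<in> borel_measurable borel"
  unfolding dabs_powr_def[abs_def] by measurable

lemma abs_powr_has_derivative:
  assumes r: "2 \<le> r"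
  shows "((\<lambda>u. \<bar>u\<bar> powr r) has_field_derivative dabs_powr r u) (at u)"
proof (cases "u = 0")
  case True
  have "((\<lambda>y::real. \<bar>y\<bar> powr (r - 1)) \<longlongrightarrow> \<bar>0\<bar> powr (r - 1)) (at 0)"
    using r by (intro tendsto_intros tendsto_powr') auto
  then have lim: "((\<lambda>y::real. \<bar>y\<bar> powr (r - 1)) \<longlongrightarrow> 0) (at 0)" by simp
  have "((\<lambda>y::real. (\<bar>y\<bar> powr r - \<bar>0\<bar> powr r) / (y - 0)) \<longlongrightarrow> 0) (at 0)"
  proof (rule tendsto_0_le[OF lim, of _ 1])
    show "\<forall>\<^sub>F y in at 0. norm ((\<bar>y\<bar> powr r - \<bar>0\<bar> powr r) / (y - 0)) \<le> norm (\<bar>y::real\<bar> powr (r - 1)) * 1"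
      by (auto simp: eventually_at_filter powr_diff)
  qed
  then show ?thesis using True by (simp add: has_field_derivative_iff dabs_powr_def)
next
  case False
  then consider "u > 0" | "u < 0" by linarith
  then show ?thesis
  proof cases
    case 1
    have "((\<lambda>u. u powr r) has_field_derivative dabs_powr r u) (at u)"
      using 1 by (auto intro!: derivative_eq_intros simp: dabs_powr_def)
    then show ?thesis
      by (rule has_field_derivative_transform_within_open[of _ _ _ "{0<..}"]) (use 1 in auto)
  next
    case 2
    have "((\<lambda>u. (- u) powr r) has_field_derivative dabs_powr r u) (at u)"
      using 2 by (auto intro!: derivative_eq_intros simp: dabs_powr_def)
    then show ?thesis
      by (rule has_field_derivative_transform_within_open[of _ _ _ "{..<0}"]) (use 2 in auto)
  qed
qed

lemma powr_diff_le:
  fixes u v z t :: real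
  assumes t: "1 \<le> t" and uv: "0 \<le> v" "v \<le> u" "u \<le> z" "0 < z"
  shows "u powr t - v powr t \<le> t * (u - v) * z powr (t - 1)"
proof (cases "v = 0 \<or> v = u")
  case True
  show ?thesis
  proof (cases "v = u")
    case False
    then have "v = 0" "0 < u" using True uv by auto
    have "u powr t = u * u powr (t - 1)" using \<open>0 < u\<close> by (simp add: powr_diff)
    also have "\<dots> \<le> u * z powr (t - 1)" using uv t by (intro mult_left_mono powr_mono2) auto
    also have "\<dots> \<le> t * (u * z powr (t - 1))" using mult_right_mono[OF t, of "u * z powr (t - 1)"] uv by simp
    finally show ?thesis using \<open>v = 0\<close> by (simp add: mult.assoc)
  qed simp
next
  case False
  then have v: "0 < v" "v < u" using uv by auto
  have "\<exists>x. v < x \<and> x < u \<and> u powr t - v powr t = (u - v) * (t * x powr (t - 1))"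
    using v by (intro MVT2) (auto intro!: derivative_eq_intros)
  then obtain x where x: "v < x" "x < u" "u powr t - v powr t = (u - v) * (t * x powr (t - 1))" by blast
  have "x powr (t - 1) \<le> z powr (t - 1)" using x v uv t by (intro powr_mono2) auto
  then have "(u - v) * (t * x powr (t - 1)) \<le> (u - v) * (t * z powr (t - 1))"
    using v t by (intro mult_left_mono) auto
  then show ?thesis using x(3) by (simp add: mult_ac)
qed

text \<open>For equal signs the mean value theorem gives the factor r (r - 1). For opposite signs,
  where 0 lies in between, the two values are bounded separately with factor r. Both factors are at
  most r^2, and oddness covers the remaining sign patterns.\<close>

lemma dabs_powr_lipschitz:
  assumes r: "2 \<le> r" and z: "\<bar>u\<bar> \<le> z" "\<bar>v\<bar> \<le> z" "0 < z"
  shows "\<bar>dabs_powr r u - dabs_powr r v\<bar> \<le> r\<^sup>2 * \<bar>u - v\<bar> * z powr (r - 2)"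
proof -
  have rr: "r * (r - 1) \<le> r\<^sup>2" "r \<le> r\<^sup>2" using r by (auto simp: power2_eq_square algebra_simps)
  have same: "\<bar>dabs_powr r u - dabs_powr r v\<bar> \<le> r\<^sup>2 * \<bar>u - v\<bar> * z powr (r - 2)"
    if h: "0 \<le> v" "v \<le> u" "u \<le> z" for u v
  proof -
    have e: "dabs_powr r u - dabs_powr r v = r * (u powr (r - 1) - v powr (r - 1))"
      using h by (cases "u = 0"; cases "v = 0") (auto simp: dabs_powr_def algebra_simps)
    have "v powr (r - 1) \<le> u powr (r - 1)" using h r by (intro powr_mono2) auto
    then have "\<bar>dabs_powr r u - dabs_powr r v\<bar> = r * (u powr (r - 1) - v powr (r - 1))"
      using r unfolding e by (intro abs_of_nonneg mult_nonneg_nonneg) auto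
    also have "\<dots> \<le> r * ((r - 1) * (u - v) * z powr (r - 1 - 1))"
      using r h z by (intro mult_left_mono powr_diff_le) auto
    also have "\<dots> = r * (r - 1) * ((u - v) * z powr (r - 2))" by simp
    also have "\<dots> \<le> r\<^sup>2 * ((u - v) * z powr (r - 2))" using h rr by (intro mult_right_mono) auto
    finally show ?thesis using h by (simp add: mult.assoc)
  qed
  have opp: "\<bar>dabs_powr r u - dabs_powr r v\<bar> \<le> r\<^sup>2 * \<bar>u - v\<bar> * z powr (r - 2)"
    if h: "v \<le> 0" "0 \<le> u" "u \<le> z" "- v \<le> z" for u v
  proof -
    have le: "x powr (r - 1) \<le> x * z powr (r - 2)" if "0 \<le> x" "x \<le> z" for x
    proof (cases "x = 0")
      case False
      then have "x powr (r - 1) = x * x powr (r - 2)" using that by (simp add: powr_mult_base)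
      also have "\<dots> \<le> x * z powr (r - 2)" using that r by (intro mult_left_mono powr_mono2) auto
      finally show ?thesis .
    qed simp
    have e: "dabs_powr r u - dabs_powr r v = r * (u powr (r - 1) + (- v) powr (r - 1))"
      using h by (cases "u = 0"; cases "v = 0") (auto simp: dabs_powr_def algebra_simps)
    have "\<bar>dabs_powr r u - dabs_powr r v\<bar> = r * (u powr (r - 1) + (- v) powr (r - 1))"
      using r unfolding e by (intro abs_of_nonneg mult_nonneg_nonneg) auto
    also have "\<dots> \<le> r * (u * z powr (r - 2) + (- v) * z powr (r - 2))"
      using h r by (intro mult_left_mono add_mono le) auto
    also have "\<dots> = r * ((u - v) * z powr (r - 2))" by (simp add: algebra_simps)
    also have "\<dots> \<le> r\<^sup>2 * ((u - v) * z powr (r - 2))" using h rr by (intro mult_right_mono) auto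
    finally show ?thesis using h by (simp add: mult.assoc)
  qed
  have neg: "dabs_powr r (- x) = - dabs_powr r x" for x by (simp add: dabs_powr_def sgn_minus)
  consider "0 \<le> v" "v \<le> u" | "0 \<le> u" "u \<le> v" | "v \<le> 0" "0 \<le> u" | "u \<le> 0" "0 \<le> v"
    | "u \<le> v" "v \<le> 0" | "v \<le> u" "u \<le> 0" by linarith
  then show ?thesis
  proof cases
    case 1 then show ?thesis using same[of v u] z by auto
  next
    case 2 then show ?thesis using same[of u v] z by (auto simp: abs_minus_commute)
  next
    case 3 then show ?thesis using opp[of v u] z by auto
  next
    case 4 then show ?thesis using opp[of u v] z by (auto simp: abs_minus_commute)
  next
    case 5 then show ?thesis using same[of "- v" "- u"] z by (auto simp: neg abs_minus_commute)
  next
    case 6 then show ?thesis using same[of "- u" "- v"] z by (auto simp: neg abs_minus_commute)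
  qed
qed

text \<open>A first order mean value step followed by the Lipschitz bound on the derivative; z
  dominates u and every intermediate point.\<close>

lemma abs_powr_taylor:
  assumes r: "2 \<le> r" and z: "\<bar>u\<bar> + \<bar>x\<bar> \<le> z" "0 < z"
  shows "\<bar>u + x\<bar> powr r \<le> \<bar>u\<bar> powr r + x * dabs_powr r u + r\<^sup>2 * x\<^sup>2 * z powr (r - 2)"
proof -
  have "\<exists>\<xi>. \<bar>\<xi> - u\<bar> \<le> \<bar>x\<bar> \<and> \<bar>u + x\<bar> powr r - \<bar>u\<bar> powr r = x * dabs_powr r \<xi>"
  proof -
    consider "x = 0" | "0 < x" | "x < 0" by linarith
    then show ?thesis
    proof cases
      case 2
      then obtain \<xi> where "u < \<xi>" "\<xi> < u + x" "\<bar>u + x\<bar> powr r - \<bar>u\<bar> powr r = (u + x - u) * dabs_powr r \<xi>"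
        using MVT2[of u "u + x" "\<lambda>u. \<bar>u\<bar> powr r" "dabs_powr r"] abs_powr_has_derivative[OF r] by auto
      then show ?thesis by (intro exI[of _ \<xi>]) auto
    next
      case 3
      then obtain \<xi> where "u + x < \<xi>" "\<xi> < u" "\<bar>u\<bar> powr r - \<bar>u + x\<bar> powr r = (u - (u + x)) * dabs_powr r \<xi>"
        using MVT2[of "u + x" u "\<lambda>u. \<bar>u\<bar> powr r" "dabs_powr r"] abs_powr_has_derivative[OF r] by auto
      then show ?thesis by (intro exI[of _ \<xi>]) auto
    qed (auto intro: exI[of _ u])
  qed
  then obtain \<xi> where \<xi>: "\<bar>\<xi> - u\<bar> \<le> \<bar>x\<bar>" "\<bar>u + x\<bar> powr r - \<bar>u\<bar> powr r = x * dabs_powr r \<xi>" by blast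
  have "x * (dabs_powr r \<xi> - dabs_powr r u) \<le> \<bar>x\<bar> * \<bar>dabs_powr r \<xi> - dabs_powr r u\<bar>"
    by (metis abs_ge_self abs_mult)
  also have "\<dots> \<le> \<bar>x\<bar> * (r\<^sup>2 * \<bar>\<xi> - u\<bar> * z powr (r - 2))"
    using \<xi> z r by (intro mult_left_mono dabs_powr_lipschitz) auto
  also have "\<dots> \<le> \<bar>x\<bar> * (r\<^sup>2 * \<bar>x\<bar> * z powr (r - 2))"
    using \<xi> by (intro mult_left_mono mult_right_mono) auto
  also have "\<dots> = r\<^sup>2 * x\<^sup>2 * z powr (r - 2)" by (simp add: power2_eq_square mult_ac)
  finally show ?thesis using \<xi>(2) by (simp add: algebra_simps)
qed

lemma add_powr_le:
  fixes x y r :: real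
  assumes "0 \<le> x" "0 \<le> y" "0 \<le> r"
  shows "(x + y) powr r \<le> 2 powr r * (x powr r + y powr r)"
proof -
  have "(x + y) powr r \<le> (2 * max x y) powr r" using assms by (intro powr_mono2) auto
  also have "\<dots> = 2 powr r * max x y powr r" using assms by (simp add: powr_mult)
  also have "max x y powr r \<le> x powr r + y powr r" by (simp add: max_def)
  finally show ?thesis by (simp add: mult_left_mono)
qed

text \<open>Above the level l, z^(r-2) = z^r z^(-2) is traded for the r-th power at the price
  l^(-2). With l tuned to the r-th moment this takes the place of Holder's inequality.\<close>

lemma powr_truncate:
  fixes z l r :: real
  assumes "0 < z" "0 < l" "2 \<le> r"
  shows "z powr (r - 2) \<le> l powr (r - 2) + z powr r * l powr (- 2)"
    and "l < z \<Longrightarrow> z powr (r - 2) \<le> z powr r * l powr (- 2)"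
proof -
  show *: "z powr (r - 2) \<le> z powr r * l powr (- 2)" if "l < z"
  proof -
    have "z powr (r - 2) = z powr r * z powr (- 2)" by (simp add: powr_add[symmetric])
    also have "\<dots> \<le> z powr r * l powr (- 2)" using that assms by (intro mult_left_mono powr_mono2') auto
    finally show ?thesis .
  qed
  show "z powr (r - 2) \<le> l powr (r - 2) + z powr r * l powr (- 2)"
  proof (cases "l < z")
    case False
    then have "z powr (r - 2) \<le> l powr (r - 2)" using assms by (intro powr_mono2) auto
    then show ?thesis by (simp add: add_increasing2)
  qed (use * in \<open>simp add: add_increasing\<close>)
qed

text \<open>A Rio-type inequality for sums read backwards in time: the increments of \<open>\<bar>R\<bar>\<^sup>2\<^sup>q\<close> are expanded to
  second order, the first-order term telescopes, and the correlations of the unbounded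
  \<open>dabs_powr\<close>-increments are reduced to those of bounded functions by truncation.\<close>

lemma (in finite_measure) moment_bound:
  fixes X R :: "nat \<Rightarrow> 'a \<Rightarrow> real" and q D H :: real and b :: "nat \<Rightarrow> real" and n :: nat
  defines "W \<equiv> measure M (space M)"
  assumes q: "1 \<le> q" and D: "1 \<le> D" and W: "1 \<le> W" and n: "1 \<le> n"
    and X: "\<And>j. X j \<in> borel_measurable M" "\<And>j x. x \<in> space M \<Longrightarrow> \<bar>X j x\<bar> \<le> D"
    and R: "\<And>i x. R i x = (\<Sum>j=i..n. X j x)"
    and b: "\<And>j. 1 \<le> j \<Longrightarrow> 0 < b j"
    and corr: "\<And>k i h L. \<lbrakk>1 \<le> k; k < i; i \<le> n; case_prod h \<in> borel_measurable (borel \<Otimes>\<^sub>M borel);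
        \<And>u v. \<bar>h u v\<bar> \<le> L\<rbrakk> \<Longrightarrow>
      \<bar>\<integral>x. X k x * h (R i x) (R (Suc i) x) \<partial>M\<bar> \<le> L * b (i - k)"
    and H: "(\<Sum>j=1..n. b j powr (1 / q)) \<le> H"
  shows "(\<integral>x. \<bar>R 1 x\<bar> powr (2 * q) \<partial>M)
    \<le> (2 powr (2 * q) * (2 * (2 * q)\<^sup>2 * D\<^sup>2 + D powr (2 * q)) * (W + 1) * (real n * (1 + H))) powr q"
proof -
  define r where "r = 2 * q"
  have r: "2 \<le> r" using q by (simp add: r_def)
  \<comment> \<open>Since X i is bounded by D, \<open>Z (Suc i)\<close> dominates both R i and R
    (Suc i), as the Taylor and Lipschitz bounds require; Z >= 1 keeps all bases of powers
    positive.\<close>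
  define Z where "Z = (\<lambda>i x. \<bar>R i x\<bar> + D)"
  have R_meas [measurable]: "R i \<in> borel_measurable M" for i
    using X(1) by (subst R[abs_def]) measurable
  have Z_meas [measurable]: "Z i \<in> borel_measurable M" for i unfolding Z_def by measurable
  note [measurable] = X(1)
  have R_step: "R i x = X i x + R (Suc i) x" if "i \<le> n" for i x
    using that by (simp add: R sum.atLeast_Suc_atMost)
  have R_bound: "\<bar>R i x\<bar> \<le> real n * D" if "1 \<le> i" "x \<in> space M" for i x
  proof -
    have "\<bar>R i x\<bar> \<le> (\<Sum>j=i..n. \<bar>X j x\<bar>)" unfolding R by (rule sum_abs)
    also have "\<dots> \<le> (\<Sum>j=1..n. \<bar>X j x\<bar>)" using that by (intro sum_mono2) auto
    also have "\<dots> \<le> (\<Sum>j=1..n. D)" using X(2) that by (intro sum_mono) auto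
    finally show ?thesis by simp
  qed
  define E where "E = real n * D + D"
  have Z_bound: "1 \<le> Z i x" "Z i x \<le> E" if "1 \<le> i" "x \<in> space M" for i x
    using R_bound[OF that] D by (auto simp: Z_def E_def)
  have integrable_bounded: "integrable M f"
    if "f \<in> borel_measurable M" "\<And>x. x \<in> space M \<Longrightarrow> \<bar>f x\<bar> \<le> B" for f :: "'a \<Rightarrow> real" and B
    using that by (intro integrable_const_bound[of _ B]) (auto intro!: AE_I2)
  have Z_int: "integrable M (\<lambda>x. Z i x powr t)" if "1 \<le> i" "0 \<le> t" for i t
  proof (rule integrable_bounded)
    show "\<bar>Z i x powr t\<bar> \<le> E powr t" if "x \<in> space M" for x
      using Z_bound[OF \<open>1 \<le> i\<close> that] \<open>0 \<le> t\<close> by (auto intro!: powr_mono2)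
  qed measurable
  \<comment> \<open>The index Suc n, where R is the empty sum, is included because the step at i = n
    uses \<open>Z (Suc i)\<close>. Everything is estimated in terms of U itself; the resulting
    inequality U <= Q U^(1-1/q) is solved at the end.\<close>
  define U where "U = Max ((\<lambda>i. \<integral>x. Z i x powr r \<partial>M) ` {1..Suc n})"
  have U_ge: "(\<integral>x. Z i x powr r \<partial>M) \<le> U" if "1 \<le> i" "i \<le> Suc n" for i
    unfolding U_def using that by (intro Max_ge) auto
  have U1: "1 \<le> U"
  proof -
    have "1 \<le> W" by (rule W)
    also have "W = (\<integral>x. 1 \<partial>M)" by (simp add: W_def)
    also have "\<dots> \<le> (\<integral>x. Z 1 x powr r \<partial>M)"
      using Z_int[of 1 r] r Z_bound(1)[of 1] by (intro integral_mono) (auto intro!: ge_one_powr_ge_zero)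
    also have "\<dots> \<le> U" by (rule U_ge) auto
    finally show ?thesis .
  qed
  define U' where "U' = U powr (1 - 1 / q)"
  have U': "1 \<le> U'" "U' * U powr (1 / q) = U"
    using U1 q by (auto simp: U'_def ge_one_powr_ge_zero simp flip: powr_add)
  \<comment> \<open>The level (U / \<beta>)^(1/r) equalises the two costs of truncation: l^(r-2)
    \<beta> from the bounded part and U l^(-2) from the tail. Both become U' \<beta>^(1/q).\<close>
  have trunc1: "((U / \<beta>) powr (1 / r)) powr (r - 2) * \<beta> = U' * \<beta> powr (1 / q)" if "0 < \<beta>" for \<beta>
  proof -
    have "1 / r * (r - 2) = 1 - 1 / q" using q by (simp add: r_def field_simps)
    then have "((U / \<beta>) powr (1 / r)) powr (r - 2) = (U / \<beta>) powr (1 - 1 / q)"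
      by (simp only: powr_powr)
    also have "\<dots> = U' * (1 / \<beta>) powr (1 - 1 / q)"
      using that U1 by (simp add: powr_divide U'_def)
    moreover have "(1 / \<beta>) powr (1 - 1 / q) * \<beta> = \<beta> powr (1 / q)"
      using that by (simp add: powr_divide powr_diff)
    ultimately show ?thesis by simp
  qed
  have trunc2: "U * ((U / \<beta>) powr (1 / r)) powr (- 2) = U' * \<beta> powr (1 / q)" if "0 < \<beta>" for \<beta>
  proof -
    have "1 / r * (- 2) = - 1 / q" using q by (simp add: r_def field_simps)
    then have "((U / \<beta>) powr (1 / r)) powr (- 2) = (U / \<beta>) powr (- 1 / q)"
      by (simp only: powr_powr)
    also have "\<dots> = U powr (- 1 / q) * \<beta> powr (1 / q)"
      using that U1 by (simp add: powr_divide powr_minus field_simps)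
    moreover have "U * U powr (- 1 / q) = U'"
      using U1 by (simp add: U'_def powr_diff powr_minus field_simps)
    ultimately show ?thesis by (simp add: mult.assoc[symmetric])
  qed
  have second: "(\<integral>x. Z i x powr (r - 2) \<partial>M) \<le> (W + 1) * U'" if i: "1 \<le> i" "i \<le> Suc n" for i
  proof -
    define l where "l = (U / 1) powr (1 / r)"
    have l: "0 < l" using U1 by (simp add: l_def)
    have "(\<integral>x. Z i x powr (r - 2) \<partial>M) \<le> (\<integral>x. l powr (r - 2) + Z i x powr r * l powr (- 2) \<partial>M)"
    proof (rule integral_mono)
      show "Z i x powr (r - 2) \<le> l powr (r - 2) + Z i x powr r * l powr (- 2)" if "x \<in> space M" for x
        using Z_bound(1)[OF i(1) that] l r by (intro powr_truncate) auto
    qed (use Z_int[OF i(1)] r in auto)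
    also have "\<dots> = W * l powr (r - 2) + (\<integral>x. Z i x powr r \<partial>M) * l powr (- 2)"
      using Z_int[OF i(1)] r by (simp add: W_def)
    also have "\<dots> \<le> W * l powr (r - 2) + U * l powr (- 2)"
      using U_ge[OF i] by (intro add_mono mult_right_mono) auto
    also have "\<dots> = (W + 1) * U'"
      using trunc1[of 1] trunc2[of 1] by (simp add: l_def algebra_simps)
    finally show ?thesis .
  qed
  define Y where "Y = (\<lambda>i x. dabs_powr r (R i x) - dabs_powr r (R (Suc i) x))"
  have Y_meas [measurable]: "Y i \<in> borel_measurable M" for i unfolding Y_def by measurable
  have Y_bound: "\<bar>Y i x\<bar> \<le> r\<^sup>2 * D * Z (Suc i) x powr (r - 2)" if "i \<le> n" "x \<in> space M" for i x
  proof -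
    have "\<bar>Y i x\<bar> \<le> r\<^sup>2 * \<bar>R i x - R (Suc i) x\<bar> * Z (Suc i) x powr (r - 2)"
      unfolding Y_def using R_step[OF that(1), of x] X(2)[OF that(2), of i] D r
      by (intro dabs_powr_lipschitz) (auto simp: Z_def)
    also have "\<dots> \<le> r\<^sup>2 * D * Z (Suc i) x powr (r - 2)"
      using R_step[OF that(1), of x] X(2)[OF that(2), of i] by (intro mult_right_mono mult_left_mono) auto
    finally show ?thesis .
  qed
  have XY_int: "integrable M (\<lambda>x. X k x * Y i x)" if "1 \<le> i" "i \<le> n" for k i
  proof (rule integrable_bounded)
    show "\<bar>X k x * Y i x\<bar> \<le> D * (r\<^sup>2 * D * E powr (r - 2))" if x: "x \<in> space M" for x
    proof -
      have "Z (Suc i) x powr (r - 2) \<le> E powr (r - 2)"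
        using Z_bound[of "Suc i" x] x r by (intro powr_mono2) auto
      then have "r\<^sup>2 * D * Z (Suc i) x powr (r - 2) \<le> r\<^sup>2 * D * E powr (r - 2)"
        using D by (intro mult_left_mono) auto
      then show ?thesis unfolding abs_mult
        using Y_bound[OF \<open>i \<le> n\<close> x] X(2)[OF x, of k] D by (intro mult_mono) auto
    qed
  qed measurable
  have XY: "(\<integral>x. X k x * Y i x \<partial>M) \<le> 2 * r\<^sup>2 * D\<^sup>2 * U' * b (i - k) powr (1 / q)"
    if k: "1 \<le> k" "k < i" "i \<le> n" for k i
  proof -
    define \<beta> where "\<beta> = b (i - k)"
    have \<beta>: "0 < \<beta>" using b k by (simp add: \<beta>_def)
    define l where "l = (U / \<beta>) powr (1 / r)"
    have l: "0 < l" using U1 \<beta> by (simp add: l_def)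
    \<comment> \<open>The increment of \<open>dabs_powr r\<close>, cut off where Z (Suc i) > l. The
      condition on u - v always holds at the points (R i x, R (Suc i) x); it makes h bounded on the
      whole plane, as \<open>corr\<close> demands.\<close>
    define h where "h = (\<lambda>u v. if \<bar>v\<bar> + D \<le> l \<and> \<bar>u - v\<bar> \<le> D then dabs_powr r u - dabs_powr r v else 0)"
    have h_meas: "case_prod h \<in> borel_measurable (borel \<Otimes>\<^sub>M borel)"
      unfolding h_def by measurable
    have h_bound: "\<bar>h u v\<bar> \<le> r\<^sup>2 * D * l powr (r - 2)" for u v
    proof (cases "\<bar>v\<bar> + D \<le> l \<and> \<bar>u - v\<bar> \<le> D")
      case True
      then have "\<bar>h u v\<bar> \<le> r\<^sup>2 * \<bar>u - v\<bar> * l powr (r - 2)"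
        using r l D by (simp add: h_def) (intro dabs_powr_lipschitz, auto)
      also have "\<dots> \<le> r\<^sup>2 * D * l powr (r - 2)" using True by (intro mult_right_mono mult_left_mono) auto
      finally show ?thesis .
    qed (use D in \<open>auto simp: h_def\<close>)
    let ?h = "\<lambda>x. h (R i x) (R (Suc i) x)"
    have h_meas' [measurable]: "?h \<in> borel_measurable M"
      using measurable_compose[OF _ h_meas, of "\<lambda>x. (R i x, R (Suc i) x)" M] by simp
    have hR: "?h x = (if Z (Suc i) x \<le> l then Y i x else 0)" if "x \<in> space M" for x
      using R_step[OF k(3), of x] X(2)[OF that, of i] by (auto simp: h_def Z_def Y_def)
    have h_int: "integrable M (\<lambda>x. X k x * ?h x)"
    proof (rule integrable_bounded)
      show "\<bar>X k x * ?h x\<bar> \<le> D * (r\<^sup>2 * D * l powr (r - 2))" if "x \<in> space M" for x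
        unfolding abs_mult using h_bound X(2)[OF that] D by (intro mult_mono) auto
    qed measurable
    have "(\<integral>x. X k x * Y i x \<partial>M) = (\<integral>x. X k x * ?h x \<partial>M) + (\<integral>x. X k x * Y i x - X k x * ?h x \<partial>M)"
      using h_int XY_int[of i k] k by simp
    also have "(\<integral>x. X k x * ?h x \<partial>M) \<le> r\<^sup>2 * D * l powr (r - 2) * \<beta>"
      using corr[OF k h_meas h_bound] unfolding \<beta>_def by (rule order_trans[OF abs_ge_self])
    also have "(\<integral>x. X k x * Y i x - X k x * ?h x \<partial>M) \<le> (\<integral>x. r\<^sup>2 * D\<^sup>2 * l powr (- 2) * Z (Suc i) x powr r \<partial>M)"
    proof (rule integral_mono)
      show "integrable M (\<lambda>x. X k x * Y i x - X k x * ?h x)" using h_int XY_int[of i k] k by simp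
      show "integrable M (\<lambda>x. r\<^sup>2 * D\<^sup>2 * l powr (- 2) * Z (Suc i) x powr r)" using Z_int[of "Suc i" r] r by simp
      fix x assume x: "x \<in> space M"
      show "X k x * Y i x - X k x * ?h x \<le> r\<^sup>2 * D\<^sup>2 * l powr (- 2) * Z (Suc i) x powr r"
      proof (cases "Z (Suc i) x \<le> l")
        case False
        then have "X k x * Y i x - X k x * ?h x \<le> \<bar>X k x\<bar> * \<bar>Y i x\<bar>"
          using abs_ge_self[of "X k x * Y i x"] by (simp add: hR[OF x] abs_mult)
        also have "\<dots> \<le> D * (r\<^sup>2 * D * Z (Suc i) x powr (r - 2))"
          using Y_bound[OF k(3) x] X(2)[OF x, of k] D by (intro mult_mono) auto
        also have "\<dots> \<le> D * (r\<^sup>2 * D * (Z (Suc i) x powr r * l powr (- 2)))"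
          using powr_truncate(2)[of "Z (Suc i) x" l r] False Z_bound(1)[of "Suc i" x] x l r D
          by (intro mult_left_mono) auto
        finally show ?thesis by (simp add: power2_eq_square mult_ac)
      qed (simp add: hR[OF x])
    qed
    also have "\<dots> = r\<^sup>2 * D\<^sup>2 * l powr (- 2) * (\<integral>x. Z (Suc i) x powr r \<partial>M)" by simp
    also have "\<dots> \<le> r\<^sup>2 * D\<^sup>2 * l powr (- 2) * U"
      using U_ge[of "Suc i"] k by (intro mult_left_mono) auto
    finally have "(\<integral>x. X k x * Y i x \<partial>M)
        \<le> r\<^sup>2 * D * (l powr (r - 2) * \<beta>) + r\<^sup>2 * D\<^sup>2 * (U * l powr (- 2))" by (simp add: mult_ac)
    also have "\<dots> = (r\<^sup>2 * D + r\<^sup>2 * D\<^sup>2) * (U' * \<beta> powr (1 / q))"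
      using trunc1[OF \<beta>] trunc2[OF \<beta>] by (simp add: l_def algebra_simps)
    also have "\<dots> \<le> (2 * r\<^sup>2 * D\<^sup>2) * (U' * \<beta> powr (1 / q))"
    proof (rule mult_right_mono)
      have "D \<le> D\<^sup>2" using D by (simp add: power2_eq_square)
      then show "r\<^sup>2 * D + r\<^sup>2 * D\<^sup>2 \<le> 2 * r\<^sup>2 * D\<^sup>2" using mult_left_mono[of D "D\<^sup>2" "r\<^sup>2"] by (simp add: mult.commute)
    qed (use U' in simp)
    finally show ?thesis by (simp add: \<beta>_def mult_ac)
  qed
  define V where "V = (\<lambda>i. \<integral>x. \<bar>R i x\<bar> powr r \<partial>M)"
  have V_int: "integrable M (\<lambda>x. \<bar>R i x\<bar> powr r)" if "1 \<le> i" for i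
  proof (rule integrable_bounded)
    show "\<bar>\<bar>R i x\<bar> powr r\<bar> \<le> (real n * D) powr r" if "x \<in> space M" for x
      using R_bound[OF \<open>1 \<le> i\<close> that] r by (auto intro!: powr_mono2)
  qed measurable
  have H0: "0 \<le> H" using H by (intro order_trans[OF _ H] sum_nonneg) auto
  have step: "V k \<le> V (Suc k) + 2 * r\<^sup>2 * D\<^sup>2 * (W + 1) * (1 + H) * U'" if k: "1 \<le> k" "k \<le> n" for k
  proof -
    \<comment> \<open>The empty sum R (Suc n) ends the telescope at 0. Each increment Y i has i > k,
      so it can be tested against X k by the correlation hypothesis.\<close>
    have tele: "dabs_powr r (R (Suc k) x) = (\<Sum>i=Suc k..n. Y i x)" for x
    proof -
      have "(\<Sum>i=Suc k..n. dabs_powr r (R (Suc i) x) - dabs_powr r (R i x))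
          = dabs_powr r (R (Suc n) x) - dabs_powr r (R (Suc k) x)"
        using k by (intro sum_Suc_diff) auto
      moreover have "dabs_powr r (R (Suc n) x) = 0" by (simp add: R dabs_powr_def)
      moreover have "(\<Sum>i=Suc k..n. Y i x) = - (\<Sum>i=Suc k..n. dabs_powr r (R (Suc i) x) - dabs_powr r (R i x))"
        unfolding Y_def sum_negf[symmetric] by simp
      ultimately show ?thesis by simp
    qed
    have ints: "integrable M (\<lambda>x. \<bar>R k x\<bar> powr r)" "integrable M (\<lambda>x. \<bar>R (Suc k) x\<bar> powr r)"
      "integrable M (\<lambda>x. \<Sum>i=Suc k..n. X k x * Y i x)" "integrable M (\<lambda>x. r\<^sup>2 * D\<^sup>2 * Z (Suc k) x powr (r - 2))"
      using V_int k Z_int[of "Suc k" "r - 2"] r by (auto intro!: Bochner_Integration.integrable_sum XY_int)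
    have "V k \<le> (\<integral>x. \<bar>R (Suc k) x\<bar> powr r + (\<Sum>i=Suc k..n. X k x * Y i x) + r\<^sup>2 * D\<^sup>2 * Z (Suc k) x powr (r - 2) \<partial>M)"
      unfolding V_def
    proof (rule integral_mono)
      fix x assume x: "x \<in> space M"
      have "\<bar>R (Suc k) x + X k x\<bar> powr r \<le> \<bar>R (Suc k) x\<bar> powr r + X k x * dabs_powr r (R (Suc k) x)
          + r\<^sup>2 * (X k x)\<^sup>2 * Z (Suc k) x powr (r - 2)"
        using X(2)[OF x, of k] D r by (intro abs_powr_taylor) (auto simp: Z_def)
      also have "\<dots> \<le> \<bar>R (Suc k) x\<bar> powr r + X k x * dabs_powr r (R (Suc k) x)
          + r\<^sup>2 * D\<^sup>2 * Z (Suc k) x powr (r - 2)"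
        using X(2)[OF x, of k] abs_le_square_iff[of "X k x" D] D
        by (intro add_left_mono mult_right_mono mult_left_mono) auto
      finally show "\<bar>R k x\<bar> powr r \<le> \<bar>R (Suc k) x\<bar> powr r + (\<Sum>i=Suc k..n. X k x * Y i x)
          + r\<^sup>2 * D\<^sup>2 * Z (Suc k) x powr (r - 2)"
        using R_step[OF k(2), of x] by (simp add: tele sum_distrib_left add.commute)
    qed (use ints in \<open>auto intro!: Bochner_Integration.integrable_add\<close>)
    also have "\<dots> = V (Suc k) + (\<integral>x. (\<Sum>i=Suc k..n. X k x * Y i x) \<partial>M)
        + (\<integral>x. r\<^sup>2 * D\<^sup>2 * Z (Suc k) x powr (r - 2) \<partial>M)"
      unfolding V_def using ints by (simp add: Bochner_Integration.integral_add del: integral_mult_right)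
    also have "\<dots> = V (Suc k) + (\<Sum>i=Suc k..n. \<integral>x. X k x * Y i x \<partial>M) + r\<^sup>2 * D\<^sup>2 * (\<integral>x. Z (Suc k) x powr (r - 2) \<partial>M)"
      using XY_int k by (subst Bochner_Integration.integral_sum) auto
    also have "\<dots> \<le> V (Suc k) + (\<Sum>i=Suc k..n. 2 * r\<^sup>2 * D\<^sup>2 * U' * b (i - k) powr (1 / q)) + r\<^sup>2 * D\<^sup>2 * ((W + 1) * U')"
      using XY k second[of "Suc k"] by (intro add_mono sum_mono mult_left_mono) auto
    also have "(\<Sum>i=Suc k..n. 2 * r\<^sup>2 * D\<^sup>2 * U' * b (i - k) powr (1 / q)) \<le> 2 * r\<^sup>2 * D\<^sup>2 * U' * H"
    proof -
      have "(\<Sum>i=Suc k..n. b (i - k) powr (1 / q)) = (\<Sum>j=1..n-k. b j powr (1 / q))"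
        using k by (intro sum.reindex_bij_witness[of _ "\<lambda>j. j + k" "\<lambda>i. i - k"]) auto
      also have "\<dots> \<le> (\<Sum>j=1..n. b j powr (1 / q))" by (intro sum_mono2) auto
      also have "\<dots> \<le> H" by (rule H)
      finally show ?thesis using U' unfolding sum_distrib_left[symmetric] by (intro mult_left_mono) auto
    qed
    also have "V (Suc k) + 2 * r\<^sup>2 * D\<^sup>2 * U' * H + r\<^sup>2 * D\<^sup>2 * ((W + 1) * U')
        = V (Suc k) + r\<^sup>2 * D\<^sup>2 * U' * (2 * H + (W + 1))" by (simp add: algebra_simps)
    also have "\<dots> \<le> V (Suc k) + r\<^sup>2 * D\<^sup>2 * U' * (2 * (W + 1) * (1 + H))"
    proof -
      have "0 \<le> W * H" using W H0 by simp
      then show ?thesis using W H0 U' by (intro add_left_mono mult_left_mono) (auto simp: algebra_simps)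
    qed
    also have "r\<^sup>2 * D\<^sup>2 * U' * (2 * (W + 1) * (1 + H)) = 2 * r\<^sup>2 * D\<^sup>2 * (W + 1) * (1 + H) * U'"
      by (simp add: algebra_simps)
    finally show ?thesis by simp
  qed
  define S where "S = 2 * r\<^sup>2 * D\<^sup>2 * (W + 1) * (1 + H) * U'"
  have S0: "0 \<le> S" using W H0 U' by (simp add: S_def)
  have V_le: "V (Suc n - i) \<le> real i * S" if "i \<le> n" for i
    using that
  proof (induction i)
    case 0
    have "V (Suc n) = 0" using r by (simp add: V_def R)
    then show ?case by simp
  next
    case (Suc i)
    have e: "Suc (Suc n - Suc i) = Suc n - i" using Suc.prems by simp
    have "V (Suc n - Suc i) \<le> V (Suc n - i) + S"
      using step[of "Suc n - Suc i"] Suc.prems unfolding e S_def by simp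
    then show ?case using Suc by (simp add: algebra_simps)
  qed
  define Q where "Q = 2 powr r * (2 * r\<^sup>2 * D\<^sup>2 + D powr r) * (W + 1) * (real n * (1 + H))"
  have Q0: "0 \<le> Q" using W H0 by (simp add: Q_def)
  have "U \<le> Q * U'"
    unfolding U_def
  proof (intro Max.boundedI, goal_cases)
    case (3 y)
    then obtain i where i: "1 \<le> i" "i \<le> Suc n" and y: "y = (\<integral>x. Z i x powr r \<partial>M)" by auto
    have "y \<le> (\<integral>x. 2 powr r * (\<bar>R i x\<bar> powr r + D powr r) \<partial>M)"
      unfolding y Z_def using Z_int[OF i(1), of r] V_int[OF i(1)] r D
      by (intro integral_mono add_powr_le) (auto simp: Z_def)
    also have "\<dots> = 2 powr r * (V i + D powr r * W)"
      unfolding V_def using V_int[OF i(1)] by (simp add: W_def)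
    also have "\<dots> \<le> 2 powr r * (real n * S + D powr r * W)"
    proof -
      have "V i \<le> real (Suc n - i) * S" using V_le[of "Suc n - i"] i by simp
      also have "\<dots> \<le> real n * S" using S0 i by (intro mult_right_mono) auto
      finally show ?thesis by (intro mult_left_mono add_right_mono) auto
    qed
    also have "\<dots> \<le> 2 powr r * (real n * S + D powr r * ((W + 1) * (real n * (1 + H)) * U'))"
    proof -
      have "1 * 1 \<le> real n * (1 + H)" using n H0 by (intro mult_mono) auto
      then have "(W + 1) * 1 * 1 \<le> (W + 1) * (real n * (1 + H)) * U'"
        using W U' by (intro mult_mono) auto
      then show ?thesis by (intro mult_left_mono add_left_mono) auto
    qed
    also have "\<dots> = Q * U'" by (simp add: Q_def S_def algebra_simps)
    finally show ?case .
  qed auto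
  \<comment> \<open>U factors as U' times U^(1/q); cancelling U' >= 1 solves the self-referential
    bound.\<close>
  then have "U powr (1 / q) * U' \<le> Q * U'" using U' by (simp add: mult.commute)
  then have "U powr (1 / q) \<le> Q" using U' by simp
  then have "(U powr (1 / q)) powr q \<le> Q powr q" using q by (intro powr_mono2) auto
  then have "U \<le> Q powr q" using q U1 by (simp add: powr_powr)
  moreover have "V 1 \<le> U"
  proof -
    have "V 1 \<le> (\<integral>x. Z 1 x powr r \<partial>M)"
      unfolding V_def using V_int[of 1] Z_int[of 1 r] r D by (intro integral_mono powr_mono2) (auto simp: Z_def)
    also have "\<dots> \<le> U" by (rule U_ge) auto
    finally show ?thesis .
  qed
  ultimately show ?thesis by (simp add: V_def Q_def r_def)
qed

section \<open>Decay of correlations and the moment estimates\<close>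

lemma decr_density_mult:
  assumes h: "decr_density h" and m: "m \<in> borel_measurable borel" "\<And>x. x \<in> {0..1} \<Longrightarrow> 0 \<le> m x"
    "\<And>x. x \<in> {0..1} \<Longrightarrow> m x \<le> B" "\<And>x y. \<lbrakk>0 \<le> x; x \<le> y; y \<le> 1\<rbrakk> \<Longrightarrow> m y \<le> m x"
  shows "decr_density (\<lambda>x. h x * m x)"
    and "t \<in> {0..1} \<Longrightarrow> integral {0..t} (\<lambda>x. h x * m x) \<le> B * integral {0..t} h"
proof -
  have i: "(\<lambda>x. h x * m x) absolutely_integrable_on {0..1}"
    using m(2,3) by (intro absolutely_integrable_mult_bounded[OF decr_densityD(1)[OF h] _ m(1), of B]) auto
  show d: "decr_density (\<lambda>x. h x * m x)"
    using i m decr_densityD(2,3)[OF h]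
    by (auto simp: decr_density_def monotone_on_def intro!: mult_nonneg_nonneg mult_mono)
  show "integral {0..t} (\<lambda>x. h x * m x) \<le> B * integral {0..t} h" if t: "t \<in> {0..1}"
  proof -
    have ih: "h integrable_on {0..t}" "(\<lambda>x. h x * m x) integrable_on {0..t}"
      using decr_density_integrable[OF h, of 0 t] decr_density_integrable[OF d, of 0 t] t by auto
    have "(t - 0) * 0 \<le> integral {0..t} (\<lambda>x. B * h x - h x * m x)"
    proof (rule integral_lower_const)
      show "(\<lambda>x. B * h x - h x * m x) integrable_on {0..t}"
        using ih by (intro integrable_diff integrable_on_mult_right)
      show "0 \<le> B * h x - h x * m x" if "0 < x" "x \<in> {0..t}" for x
        using mult_left_mono[OF m(3)[of x] decr_densityD(2)[OF h, of x]] that t by (simp add: mult.commute)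
    qed (use t in auto)
    also have "\<dots> = B * integral {0..t} h - integral {0..t} (\<lambda>x. h x * m x)"
      using ih by (subst integral_diff) (auto intro: integrable_on_mult_right)
    finally show ?thesis by simp
  qed
qed

context
  fixes \<alpha> :: real
  assumes \<alpha>: "0 < \<alpha>" "\<alpha> < 1"
begin

text \<open>\<open>(\<phi> - c) h\<close> is the difference of the decreasing densities \<open>h (\<phi> - K x + 3 K)\<close> and
  \<open>h (3 K + c - K x)\<close>, to which loss of memory applies.\<close>

lemma decay_of_correlations:
  assumes w: "decr_density w" and wB: "initial_bound \<alpha> B w" "4 / (1 - \<alpha>) * integral {0..1} w \<le> B"
    and W: "0 < integral {0..1} w" and K: "0 \<le> K"
  obtains Q where "0 \<le> Q" "\<And>a \<phi> k n g L. \<lbrakk>admissible \<alpha> a; n \<ge> 1; \<phi> \<in> borel_measurable borel;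
      \<And>x. \<bar>\<phi> x\<bar> \<le> K; \<And>x y. \<bar>\<phi> x - \<phi> y\<bar> \<le> K * \<bar>x - y\<bar>;
      g \<in> borel_measurable borel; \<And>x. \<bar>g x\<bar> \<le> L\<rbrakk> \<Longrightarrow>
    \<bar>integral {0..1} (\<lambda>x. w x *
        ((\<phi> (seq_comp a k x) - integral {0..1} (\<lambda>x. w x * \<phi> (seq_comp a k x)) / integral {0..1} w)
          * g (seq_comp a (k + n) x)))\<bar> \<le> L * (Q * real n powr - (1 / \<alpha> - 1))"
proof -
  have B: "0 \<le> B" using W \<alpha> by (intro order_trans[OF _ wB(2)]) auto
  \<comment> \<open>On [0, 1] the decreasing multipliers below take values in [0, 5 K], so the
    products inherit the mass bound with constant 5 K B.\<close>
  have KB: "0 \<le> 5 * K * B" using B K by simp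
  obtain Q where Q: "0 \<le> Q" "\<And>a f1 f2 n g L. \<lbrakk>admissible \<alpha> a; n \<ge> 1;
      decr_density f1; initial_bound \<alpha> (5 * K * B) f1; decr_density f2; initial_bound \<alpha> (5 * K * B) f2;
      integral {0..1} f1 = integral {0..1} f2; 4 / (1 - \<alpha>) * integral {0..1} f1 \<le> 5 * K * B;
      g \<in> borel_measurable borel; \<And>x. \<bar>g x\<bar> \<le> L\<rbrakk> \<Longrightarrow>
    \<bar>integral {0..1} (\<lambda>x. f1 x * g (seq_comp a n x)) - integral {0..1} (\<lambda>x. f2 x * g (seq_comp a n x))\<bar>
      \<le> L * (Q * real n powr - (1 / \<alpha> - 1))"
    using loss_of_memory[OF \<alpha> KB] by blast
  show thesis
  proof (rule that[OF Q(1)])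
    fix a k n and \<phi> g :: "real \<Rightarrow> real" and L
    assume a: "admissible \<alpha> a" and n: "n \<ge> (1::nat)"
      and \<phi>: "\<phi> \<in> borel_measurable borel" "\<And>x. \<bar>\<phi> x\<bar> \<le> K" "\<And>x y. \<bar>\<phi> x - \<phi> y\<bar> \<le> K * \<bar>x - y\<bar>"
      and g: "g \<in> borel_measurable borel" "\<And>x. \<bar>g x\<bar> \<le> L"
    define a' where "a' = (\<lambda>i. a (i + k))"
    have a': "admissible \<alpha> a'" unfolding a'_def using a by (rule admissible_shift)
    define h where "h = push a k w"
    have h: "decr_density h" "initial_bound \<alpha> B h" "integral {0..1} h = integral {0..1} w"
      unfolding h_def using push_decr[OF \<alpha> a w] push_initial_bound[OF \<alpha> a w wB] push_mass[OF \<alpha> a w] by auto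
    have dual: "integral {0..1} (\<lambda>x. w x * f (seq_comp a k x)) = integral {0..1} (\<lambda>x. h x * f x)"
      if "f \<in> borel_measurable borel" "\<And>x. \<bar>f x\<bar> \<le> L" for f L
      unfolding h_def using push_duality[OF \<alpha> a w that] .
    have int: "(\<lambda>x. f x * m x) integrable_on {0..1}"
      if "decr_density f" "m \<in> borel_measurable borel" "\<And>x. x \<in> {0..1} \<Longrightarrow> \<bar>m x\<bar> \<le> L" for f m L
      using absolutely_integrable_mult_bounded[OF decr_densityD(1)[OF that(1)] _ that(2), of L] that(3)
        set_lebesgue_integral_eq_integral(1) by auto
    define c where "c = integral {0..1} (\<lambda>x. w x * \<phi> (seq_comp a k x)) / integral {0..1} w"
    have c_eq: "integral {0..1} (\<lambda>x. h x * \<phi> x) = c * integral {0..1} w"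
      using dual[OF \<phi>(1,2)] W by (simp add: c_def)
    have "\<bar>integral {0..1} (\<lambda>x. h x * \<phi> x)\<bar> \<le> K * integral {0..1} w"
      using integral_mult_le[OF h(1) \<phi>(1,2)] h(3) by simp
    then have "\<bar>c\<bar> * integral {0..1} w \<le> K * integral {0..1} w" unfolding c_eq abs_mult using W by simp
    then have c: "\<bar>c\<bar> \<le> K" using W by simp
    \<comment> \<open>Subtracting K x makes the K-Lipschitz function decreasing, and 3 K restores
      positivity. As c is the mean of \<phi> under h, both products have the same mass.\<close>
    define m1 where "m1 = (\<lambda>x. \<phi> x - K * x + 3 * K)"
    define m2 where "m2 = (\<lambda>x. 3 * K + c - K * x)"
    have m1: "m1 \<in> borel_measurable borel" unfolding m1_def using \<phi>(1) by measurable
    have m2: "m2 \<in> borel_measurable borel" unfolding m2_def by measurable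
    have Kx: "0 \<le> K * x" "K * x \<le> K" if "x \<in> {0..1}" for x
      using that K mult_left_mono[of x 1 K] by auto
    have m1b: "0 \<le> m1 x" "m1 x \<le> 5 * K" if "x \<in> {0..1}" for x
      using Kx[OF that] \<phi>(2)[of x] K by (auto simp: m1_def)
    have m2b: "0 \<le> m2 x" "m2 x \<le> 5 * K" if "x \<in> {0..1}" for x
      using Kx[OF that] c K by (auto simp: m2_def)
    have m1d: "m1 y \<le> m1 x" if "x \<le> y" for x y
      using \<phi>(3)[of y x] that by (auto simp: m1_def algebra_simps)
    have m2d: "m2 y \<le> m2 x" if "x \<le> y" for x y
      using that K mult_left_mono[of x y K] by (auto simp: m2_def)
    define F1 where "F1 = (\<lambda>x. h x * m1 x)"
    define F2 where "F2 = (\<lambda>x. h x * m2 x)"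
    have F1: "decr_density F1" "\<And>t. t \<in> {0..1} \<Longrightarrow> integral {0..t} F1 \<le> 5 * K * integral {0..t} h"
      unfolding F1_def using decr_density_mult[OF h(1) m1 m1b m1d] by auto
    have F2: "decr_density F2" "\<And>t. t \<in> {0..1} \<Longrightarrow> integral {0..t} F2 \<le> 5 * K * integral {0..t} h"
      unfolding F2_def using decr_density_mult[OF h(1) m2 m2b m2d] by auto
    have bound: "initial_bound \<alpha> (5 * K * B) F"
      if "\<And>t. t \<in> {0..1} \<Longrightarrow> integral {0..t} F \<le> 5 * K * integral {0..t} h" for F
      unfolding initial_bound_def
    proof
      fix t :: real assume t: "t \<in> {0..1}"
      have "5 * K * integral {0..t} h \<le> 5 * K * (B * t powr (1 - \<alpha>))"
        using h(2) t K unfolding initial_bound_def by (intro mult_left_mono) auto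
      then show "integral {0..t} F \<le> 5 * K * B * t powr (1 - \<alpha>)" using that[OF t] by (simp add: mult.assoc)
    qed
    have diff: "F1 x - F2 x = h x * (\<phi> x - c)" for x
      by (simp add: F1_def F2_def m1_def m2_def algebra_simps)
    have "integral {0..1} F1 - integral {0..1} F2 = integral {0..1} (\<lambda>x. F1 x - F2 x)"
      using F1(1) F2(1) by (intro integral_diff[symmetric] decr_density_integrable) auto
    also have "\<dots> = integral {0..1} (\<lambda>x. h x * \<phi> x - c * h x)"
      unfolding diff by (simp add: algebra_simps)
    also have "\<dots> = integral {0..1} (\<lambda>x. h x * \<phi> x) - c * integral {0..1} h"
      using int[OF h(1) \<phi>(1), of K] \<phi>(2) decr_density_integrable[OF h(1), of 0 1]
      by (subst integral_diff) (auto intro: integrable_on_mult_right)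
    also have "\<dots> = 0" using c_eq h(3) by simp
    finally have mass: "integral {0..1} F1 = integral {0..1} F2" by simp
    have "4 / (1 - \<alpha>) * integral {0..1} F1 \<le> 4 / (1 - \<alpha>) * (5 * K * integral {0..1} w)"
      using F1(2)[of 1] h(3) \<alpha> by (intro mult_left_mono) auto
    also have "\<dots> = 5 * K * (4 / (1 - \<alpha>) * integral {0..1} w)" by simp
    also have "\<dots> \<le> 5 * K * B" using wB(2) K by (intro mult_left_mono) auto
    finally have mass': "4 / (1 - \<alpha>) * integral {0..1} F1 \<le> 5 * K * B" .
    have g': "(\<lambda>x. g (seq_comp a' n x)) \<in> borel_measurable borel" using g(1) by measurable
    have L: "0 \<le> L" using g(2)[of 0] by linarith
    \<comment> \<open>Apart from the weight, the integrand depends on x through the state at time k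
      only. So the first k steps are absorbed into h, and loss of memory acts during the remaining
      n.\<close>
    have "integral {0..1} (\<lambda>x. w x * ((\<phi> (seq_comp a k x) - c) * g (seq_comp a (k + n) x)))
        = integral {0..1} (\<lambda>x. w x * (\<lambda>y. (\<phi> y - c) * g (seq_comp a' n y)) (seq_comp a k x))"
      by (simp add: seq_comp_add a'_def)
    also have "\<dots> = integral {0..1} (\<lambda>x. h x * ((\<phi> x - c) * g (seq_comp a' n x)))"
    proof (rule dual)
      show "(\<lambda>y. (\<phi> y - c) * g (seq_comp a' n y)) \<in> borel_measurable borel" using \<phi>(1) g(1) by measurable
      show "\<bar>(\<phi> y - c) * g (seq_comp a' n y)\<bar> \<le> (2 * K) * L" for y
        unfolding abs_mult using \<phi>(2)[of y] c g(2)[of "seq_comp a' n y"] K by (intro mult_mono) auto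
    qed
    also have "\<dots> = integral {0..1} (\<lambda>x. F1 x * g (seq_comp a' n x) - F2 x * g (seq_comp a' n x))"
      by (simp add: left_diff_distrib[symmetric] diff mult.assoc)
    also have "\<dots> = integral {0..1} (\<lambda>x. F1 x * g (seq_comp a' n x)) - integral {0..1} (\<lambda>x. F2 x * g (seq_comp a' n x))"
      using int[OF F1(1) g', of L] int[OF F2(1) g', of L] g(2) by (intro integral_diff) auto
    finally have e: "integral {0..1} (\<lambda>x. w x * ((\<phi> (seq_comp a k x) - c) * g (seq_comp a (k + n) x)))
      = integral {0..1} (\<lambda>x. F1 x * g (seq_comp a' n x)) - integral {0..1} (\<lambda>x. F2 x * g (seq_comp a' n x))" .
    have "\<bar>integral {0..1} (\<lambda>x. w x * ((\<phi> (seq_comp a k x) - c) * g (seq_comp a (k + n) x)))\<bar>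
      \<le> L * (Q * real n powr - (1 / \<alpha> - 1))"
      unfolding e by (rule Q(2)[OF a' n F1(1) bound[OF F1(2)] F2(1) bound[OF F2(2)] mass mass' g])
    then show "\<bar>integral {0..1} (\<lambda>x. w x *
        ((\<phi> (seq_comp a k x) - integral {0..1} (\<lambda>x. w x * \<phi> (seq_comp a k x)) / integral {0..1} w)
          * g (seq_comp a (k + n) x)))\<bar> \<le> L * (Q * real n powr - (1 / \<alpha> - 1))"
      unfolding c_def .
  qed
qed

end

section \<open>Summing the decay of correlations\<close>

lemma sum_powr_le:
  fixes s :: real
  assumes "0 \<le> s" "s < 1"
  shows "(\<Sum>j=1..n. real j powr - s) \<le> real n powr (1 - s) / (1 - s)"
proof (induction n)
  case (Suc n)
  have "(1 - s) * real (Suc n) powr - s \<le> real (Suc n) powr (1 - s) - real n powr (1 - s)"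
  proof (cases "n = 0")
    case False
    then have "\<exists>x. real n < x \<and> x < real (Suc n) \<and>
        real (Suc n) powr (1 - s) - real n powr (1 - s) = (real (Suc n) - real n) * ((1 - s) * x powr (1 - s - 1))"
      by (intro MVT2) (auto intro!: derivative_eq_intros)
    then obtain x where x: "real n < x" "x < real (Suc n)"
      "real (Suc n) powr (1 - s) - real n powr (1 - s) = (1 - s) * x powr - s" by auto
    have "real (Suc n) powr - s \<le> x powr - s" using x False assms by (intro powr_mono2') auto
    then show ?thesis using x(3) assms by (simp add: mult_left_mono)
  qed (use assms in simp)
  then have "real (Suc n) powr - s \<le> (real (Suc n) powr (1 - s) - real n powr (1 - s)) / (1 - s)"
    using assms by (simp add: field_simps)
  then show ?case using Suc.IH by (simp add: diff_divide_distrib)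
qed auto

text \<open>The threshold moment \<open>q = max 1 s\<close>: the correlation sum costs \<open>ln n\<close> if \<open>s \<ge> 1\<close> and
  \<open>n powr (1 - s)\<close> otherwise.\<close>

lemma correlation_sum_bound:
  fixes s Q c :: real
  assumes s: "0 < s" and Q: "0 < Q" and c: "0 \<le> c"
  obtains C where "0 < C" "\<And>n. n \<ge> 2 \<Longrightarrow>
    (c * (real n * (1 + (\<Sum>j=1..n. (Q * real j powr - s) powr (1 / max 1 s))))) powr (max 1 s)
      \<le> C * real n powr (2 * max 1 s - s) * ln (real n) powr (s + 1)"
proof -
  define q where "q = max 1 s"
  have q: "1 \<le> q" "s \<le> q" by (auto simp: q_def)
  define P where "P = Q powr (1 / q)"
  have P: "0 < P" using Q by (simp add: P_def)
  have sum_eq: "(\<Sum>j=1..n. (Q * real j powr - s) powr (1 / q)) = P * (\<Sum>j=1..n. real j powr - (s / q))" for n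
    using Q by (simp add: P_def powr_mult powr_powr sum_distrib_left)
  have ln_ge: "1/2 \<le> ln (real n)" if "n \<ge> 2" for n
  proof -
    have "1/2 \<le> ln (2::real)" using ln_le_minus_one[of "1/2::real"] by (simp add: ln_div)
    also have "\<dots> \<le> ln (real n)" using that by simp
    finally show ?thesis .
  qed
  show thesis
  proof (cases "1 \<le> s")
    case True
    then have qs: "q = s" by (simp add: q_def)
    \<comment> \<open>The summand 1 keeps C positive even for c = 0. The final factor 2 pays for
      raising the power of the logarithm from s to s + 1, as ln n >= 1/2 for n >= 2.\<close>
    define C where "C = (c * (2 + 3 * P) + 1) powr s * 2"
    have "(c * (real n * (1 + P * (\<Sum>j=1..n. real j powr - (s / q))))) powr q
      \<le> C * real n powr (2 * q - s) * ln (real n) powr (s + 1)" if n: "n \<ge> 2" for n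
    proof -
      have "(\<Sum>j=1..n. real j powr - (s / q)) = harm n"
        using True by (simp add: qs harm_def powr_minus)
      also have "\<dots> \<le> ln (real n) + 1" using euler_mascheroni_sequence_decreasing[of 1 n] n by (simp add: harm_def)
      also have "\<dots> \<le> 3 * ln (real n)" using ln_ge[OF n] by simp
      finally have "P * (\<Sum>j=1..n. real j powr - (s / q)) \<le> P * (3 * ln (real n))"
        using P by (intro mult_left_mono) auto
      then have "1 + P * (\<Sum>j=1..n. real j powr - (s / q)) \<le> (2 + 3 * P) * ln (real n)"
        using ln_ge[OF n] by (simp add: algebra_simps)
      then have "c * (real n * (1 + P * (\<Sum>j=1..n. real j powr - (s / q)))) \<le> c * (real n * ((2 + 3 * P) * ln (real n)))"
        using c by (intro mult_left_mono) auto
      also have "\<dots> = c * (2 + 3 * P) * (real n * ln (real n))" by simp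
      also have "\<dots> \<le> (c * (2 + 3 * P) + 1) * (real n * ln (real n))"
        using ln_ge[OF n] by (intro mult_right_mono) auto
      finally have "(c * (real n * (1 + P * (\<Sum>j=1..n. real j powr - (s / q))))) powr q
        \<le> ((c * (2 + 3 * P) + 1) * (real n * ln (real n))) powr q"
        using c P q by (intro powr_mono2) (auto intro!: mult_nonneg_nonneg add_nonneg_nonneg sum_nonneg)
      also have "\<dots> = (c * (2 + 3 * P) + 1) powr s * (real n powr s * ln (real n) powr s)"
        using c P n ln_ge[OF n] by (simp add: powr_mult qs)
      also have "\<dots> \<le> (c * (2 + 3 * P) + 1) powr s * (real n powr s * (2 * ln (real n) powr (s + 1)))"
        using ln_ge[OF n] by (intro mult_left_mono) (auto simp: powr_add)
      also have "\<dots> = C * real n powr (2 * q - s) * ln (real n) powr (s + 1)"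
        by (simp add: C_def qs)
      finally show ?thesis .
    qed
    moreover have "0 < c * (2 + 3 * P) + 1" using c P by (intro add_nonneg_pos mult_nonneg_nonneg) auto
    then have "0 < C" by (simp add: C_def)
    ultimately show ?thesis
      using that[of C] unfolding q_def[symmetric] sum_eq by blast
  next
    case False
    then have q1: "q = 1" by (simp add: q_def)
    define C where "C = (c * (1 + P / (1 - s)) + 1) * 2 powr (s + 1)"
    have "(c * (real n * (1 + P * (\<Sum>j=1..n. real j powr - (s / q))))) powr q
      \<le> C * real n powr (2 * q - s) * ln (real n) powr (s + 1)" if n: "n \<ge> 2" for n
    proof -
      have "(\<Sum>j=1..n. real j powr - (s / q)) \<le> real n powr (1 - s) / (1 - s)"
        using sum_powr_le[of s n] s False by (simp add: q1)
      then have "P * (\<Sum>j=1..n. real j powr - (s / q)) \<le> P * (real n powr (1 - s) / (1 - s))"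
        using P by (intro mult_left_mono) auto
      moreover have "1 \<le> real n powr (1 - s)" using n False by (intro ge_one_powr_ge_zero) auto
      ultimately have "1 + P * (\<Sum>j=1..n. real j powr - (s / q)) \<le> (1 + P / (1 - s)) * real n powr (1 - s)"
        by (simp add: algebra_simps)
      then have "c * (real n * (1 + P * (\<Sum>j=1..n. real j powr - (s / q))))
          \<le> c * (real n * ((1 + P / (1 - s)) * real n powr (1 - s)))"
        using c by (intro mult_left_mono) auto
      also have "\<dots> = c * (1 + P / (1 - s)) * real n powr (2 - s)"
        using n powr_add[of "real n" 1 "1 - s"] by simp
      also have "\<dots> \<le> (c * (1 + P / (1 - s)) + 1) * real n powr (2 - s)" by (intro mult_right_mono) auto
      \<comment> \<open>The sum produces no logarithm for s < 1; the factor (2 ln n)^(s+1) >= 1 is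
        inserted to reach the common form.\<close>
      also have "\<dots> \<le> (c * (1 + P / (1 - s)) + 1) * real n powr (2 - s) * (2 powr (s + 1) * ln (real n) powr (s + 1))"
      proof -
        have "1 \<le> (2 * ln (real n)) powr (s + 1)" using ln_ge[OF n] s by (intro ge_one_powr_ge_zero) auto
        also have "\<dots> = 2 powr (s + 1) * ln (real n) powr (s + 1)" using ln_ge[OF n] by (simp add: powr_mult)
        finally have l: "1 \<le> 2 powr (s + 1) * ln (real n) powr (s + 1)" .
        have "0 \<le> (c * (1 + P / (1 - s)) + 1) * real n powr (2 - s)"
          using c P False by (intro mult_nonneg_nonneg add_nonneg_nonneg) auto
        from mult_left_mono[OF l this] show ?thesis by simp
      qed
      finally have b: "c * (real n * (1 + P * (\<Sum>j=1..n. real j powr - (s / q))))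
        \<le> C * real n powr (2 * q - s) * ln (real n) powr (s + 1)" by (simp add: C_def q1 mult_ac)
      have "0 \<le> c * (real n * (1 + P * (\<Sum>j=1..n. real j powr - (s / q))))"
        using c P by (auto intro!: mult_nonneg_nonneg add_nonneg_nonneg sum_nonneg)
      then show ?thesis using b by (simp add: q1)
    qed
    moreover have "0 < c * (1 + P / (1 - s)) + 1"
      using c P False by (intro add_nonneg_pos mult_nonneg_nonneg add_nonneg_nonneg) auto
    then have "0 < C" by (simp add: C_def)
    ultimately show ?thesis
      using that[of C] unfolding q_def[symmetric] sum_eq by blast
  qed
qed

text \<open>From |S| <= n D follows |S|^(2p) <= (n D)^(2p-2q) |S|^(2q), which changes n^(2q-s) into
  n^(2p-s). The constants fit into (D^2 C)^p because C and D are at least 1 and p > 1, and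
  \<open>A\<close> enters through 1 <= A. The tail is Markov's inequality at order 2p.\<close>

lemma (in finite_measure) interpolated_moment_and_tail:
  fixes S :: "'a \<Rightarrow> real" and s C D p q :: real and n :: nat
  assumes S: "S \<in> borel_measurable M" "\<And>x. x \<in> space M \<Longrightarrow> \<bar>S x\<bar> \<le> real n * D"
    and D: "1 \<le> D" and C: "1 \<le> C" and n: "n \<ge> 2" and s: "0 < s" and q: "q = max 1 s" and p: "p > q"
    and moment: "(\<integral>x. \<bar>S x\<bar> powr (2 * q) \<partial>M) \<le> C * real n powr (2 * q - s) * l"
    and A: "A = (4 * p / (1 - 1 / p * s)) powr p"
  shows "(\<integral>x. \<bar>S x\<bar> powr (2 * p) \<partial>M) \<le> A * (D\<^sup>2 * C) powr p * real n powr (2 * p + - s) * l"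
    and "0 < \<epsilon> \<Longrightarrow> measure M {x \<in> space M. \<bar>S x\<bar> > real n * \<epsilon>}
      \<le> A * (D\<^sup>2 * C) powr p * real n powr (- s) * l * \<epsilon> powr (- 2 * p)"
proof -
  note [measurable] = S(1)
  have pq: "1 < p" "s < p" "1 \<le> q" using p by (auto simp: q)
  have int: "integrable M (\<lambda>x. \<bar>S x\<bar> powr t)" if "0 \<le> t" for t
    using S(2) that by (intro integrable_const_bound[of _ "(real n * D) powr t"]) (auto intro!: AE_I2 powr_mono2)
  have A1: "1 \<le> A"
  proof -
    have d: "0 < 1 - 1 / p * s" "1 - 1 / p * s \<le> 1" using pq s by (auto simp: field_simps)
    have "1 - 1 / p * s \<le> 4 * p" using pq by (intro order_trans[OF d(2)]) simp
    with d(1) have "1 \<le> 4 * p / (1 - 1 / p * s)" by (simp only: pos_le_divide_eq mult_1)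
    then show ?thesis unfolding A using pq by (intro ge_one_powr_ge_zero) auto
  qed
  \<comment> \<open>The sign of the logarithmic factor is read off from the moment bound, whose left
    side is nonnegative.\<close>
  have l: "0 \<le> l"
  proof -
    have "0 \<le> (\<integral>x. \<bar>S x\<bar> powr (2 * q) \<partial>M)" by simp
    also note moment
    finally have "0 \<le> C * real n powr (2 * q - s) * l" .
    moreover have "0 < C * real n powr (2 * q - s)" using C n by simp
    ultimately show ?thesis by (simp add: zero_le_mult_iff)
  qed
  have "(\<integral>x. \<bar>S x\<bar> powr (2 * p) \<partial>M) \<le> (\<integral>x. (real n * D) powr (2 * p - 2 * q) * \<bar>S x\<bar> powr (2 * q) \<partial>M)"
  proof (rule integral_mono)
    fix x assume x: "x \<in> space M"
    have "\<bar>S x\<bar> powr (2 * p) = \<bar>S x\<bar> powr (2 * p - 2 * q) * \<bar>S x\<bar> powr (2 * q)"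
      by (simp add: powr_add[symmetric])
    also have "\<dots> \<le> (real n * D) powr (2 * p - 2 * q) * \<bar>S x\<bar> powr (2 * q)"
      using S(2)[OF x] p by (intro mult_right_mono powr_mono2) auto
    finally show "\<bar>S x\<bar> powr (2 * p) \<le> (real n * D) powr (2 * p - 2 * q) * \<bar>S x\<bar> powr (2 * q)" .
  qed (use int pq in auto)
  also have "\<dots> = (real n * D) powr (2 * p - 2 * q) * (\<integral>x. \<bar>S x\<bar> powr (2 * q) \<partial>M)" by simp
  also have "\<dots> \<le> (real n * D) powr (2 * p - 2 * q) * (C * real n powr (2 * q - s) * l)"
    using moment by (intro mult_left_mono) auto
  also have "\<dots> = D powr (2 * p - 2 * q) * C * (real n powr (2 * p - 2 * q) * real n powr (2 * q - s)) * l"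
    using D by (simp add: powr_mult)
  also have "real n powr (2 * p - 2 * q) * real n powr (2 * q - s) = real n powr (2 * p + - s)"
    by (simp add: powr_add[symmetric])
  also have "D powr (2 * p - 2 * q) * C * real n powr (2 * p + - s) * l
      \<le> A * (D\<^sup>2 * C) powr p * real n powr (2 * p + - s) * l"
  proof -
    have "D powr (2 * p - 2 * q) \<le> D powr (2 * p)" using D pq by (intro powr_mono) auto
    also have "\<dots> = (D\<^sup>2) powr p" using D by (simp add: powr_powr flip: powr_numeral)
    finally have "D powr (2 * p - 2 * q) * C \<le> (D\<^sup>2) powr p * C powr p"
      using C pq powr_mono[of 1 p C] by (intro mult_mono) auto
    also have "\<dots> = 1 * (D\<^sup>2 * C) powr p" using C D by (simp add: powr_mult)
    also have "\<dots> \<le> A * (D\<^sup>2 * C) powr p" using A1 by (intro mult_right_mono) auto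
    finally show ?thesis using l by (intro mult_right_mono) auto
  qed
  finally show mom: "(\<integral>x. \<bar>S x\<bar> powr (2 * p) \<partial>M) \<le> A * (D\<^sup>2 * C) powr p * real n powr (2 * p + - s) * l" .
  assume \<epsilon>: "0 < \<epsilon>"
  have n\<epsilon>: "0 < real n * \<epsilon>" using \<epsilon> n by simp
  have "measure M {x \<in> space M. \<bar>S x\<bar> > real n * \<epsilon>}
      \<le> measure M {x \<in> space M. (real n * \<epsilon>) powr (2 * p) \<le> \<bar>S x\<bar> powr (2 * p)}"
    using n\<epsilon> pq by (intro finite_measure_mono) (auto intro!: powr_mono2)
  also have "\<dots> \<le> (\<integral>x. \<bar>S x\<bar> powr (2 * p) \<partial>M) / (real n * \<epsilon>) powr (2 * p)"
    using int[of "2 * p"] pq n \<epsilon> by (intro integral_Markov_inequality_measure[where A = "{}"]) auto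
  also have "\<dots> \<le> (A * (D\<^sup>2 * C) powr p * real n powr (2 * p + - s) * l) / (real n * \<epsilon>) powr (2 * p)"
    using mom by (intro divide_right_mono) auto
  also have "\<dots> = A * (D\<^sup>2 * C) powr p * real n powr (- s) * l * \<epsilon> powr (- 2 * p)"
  proof -
    have "real n powr (2 * p + - s) = real n powr (2 * p) * real n powr (- s)" by (rule powr_add)
    moreover have "(real n * \<epsilon>) powr (2 * p) = real n powr (2 * p) * \<epsilon> powr (2 * p)"
      using \<epsilon> by (simp add: powr_mult)
    ultimately show ?thesis using n \<epsilon> by (simp add: powr_minus field_simps)
  qed
  finally show "measure M {x \<in> space M. \<bar>S x\<bar> > real n * \<epsilon>}
      \<le> A * (D\<^sup>2 * C) powr p * real n powr (- s) * l * \<epsilon> powr (- 2 * p)" .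
qed

section \<open>Observables on the interval and measures with a density\<close>

lemma C1_on_unit_bounds:
  assumes "C1_on_unit \<phi>" and K: "C1_norm \<phi> = K"
  shows "\<And>x. x \<in> {0..1} \<Longrightarrow> \<bar>\<phi> x\<bar> \<le> K"
    and "\<And>x y. \<lbrakk>x \<in> {0..1}; y \<in> {0..1}\<rbrakk> \<Longrightarrow> \<bar>\<phi> x - \<phi> y\<bar> \<le> K * \<bar>x - y\<bar>"
    and "continuous_on {0..1} \<phi>"
proof -
  have d: "\<phi> differentiable_on {0..1}" and c': "continuous_on {0..1} (deriv01 \<phi>)"
    using assms(1) by (auto simp: C1_on_unit_def)
  show c: "continuous_on {0..1} \<phi>" using d by (rule differentiable_imp_continuous_on)
  have bdd: "bdd_above ((\<lambda>x. \<bar>f x\<bar>) ` {0..1})" if "continuous_on {0..1::real} f" for f :: "real \<Rightarrow> real"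
    using that by (intro compact_imp_bounded[THEN bounded_imp_bdd_above] compact_continuous_image continuous_intros) auto
  have le: "\<bar>f x\<bar> \<le> (SUP x\<in>{0..1}. \<bar>f x\<bar>)" if "continuous_on {0..1::real} f" "x \<in> {0..1}" for f :: "real \<Rightarrow> real" and x
    using bdd[OF that(1)] that(2) by (intro cSUP_upper) auto
  have nonneg: "0 \<le> (SUP x\<in>{0..1}. \<bar>f x\<bar>)" if "continuous_on {0..1::real} f" for f :: "real \<Rightarrow> real"
    using le[OF that, of 0] by (intro order_trans[OF abs_ge_zero[of "f 0"]]) auto
  show "\<bar>\<phi> x\<bar> \<le> K" if "x \<in> {0..1}" for x
    using le[OF c that] nonneg[OF c'] K by (simp add: C1_norm_def)
  have K': "\<bar>deriv01 \<phi> x\<bar> \<le> K" if "x \<in> {0..1}" for x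
    using le[OF c' that] nonneg[OF c] K by (simp add: C1_norm_def)
  show "\<bar>\<phi> x - \<phi> y\<bar> \<le> K * \<bar>x - y\<bar>" if "x \<in> {0..1}" "y \<in> {0..1}" for x y
  proof -
    have "(\<phi> has_field_derivative deriv01 \<phi> z) (at z within {0..1})" if "z \<in> {0..1}" for z
      using d that unfolding deriv01_def has_real_derivative_iff_has_vector_derivative
      by (simp add: differentiable_on_def vector_derivative_works)
    then show ?thesis
      using field_differentiable_bound[of "{0..1}" \<phi> "deriv01 \<phi>" K x y] K' that by simp
  qed
qed

lemma integral_density_unit:
  fixes w f :: "real \<Rightarrow> real"
  assumes w: "w absolutely_integrable_on {0..1}" "w \<in> borel_measurable borel" "\<And>x. x \<in> {0..1} \<Longrightarrow> 0 \<le> w x"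
    and f: "f \<in> borel_measurable borel" "\<And>x. x \<in> {0..1} \<Longrightarrow> \<bar>f x\<bar> \<le> L"
  shows "(\<integral>x. f x \<partial>density unit_lebesgue (\<lambda>x. ennreal (w x))) = integral {0..1} (\<lambda>x. w x * f x)"
proof -
  have meas: "g \<in> borel_measurable unit_lebesgue" if "g \<in> borel_measurable borel" for g :: "real \<Rightarrow> real"
    using that by (intro measurable_restrict_space1 measurable_completion) simp
  have "(\<integral>x. f x \<partial>density unit_lebesgue (\<lambda>x. ennreal (w x))) = (\<integral>x. w x *\<^sub>R f x \<partial>unit_lebesgue)"
    using w f by (intro integral_density meas) (auto intro!: AE_I2)
  also have "\<dots> = (\<integral>x. w x * f x \<partial>unit_lebesgue)" by simp
  also have "\<dots> = integral {0..1} (\<lambda>x. w x * f x)"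
  proof (rule lebesgue_integral_eq_integral)
    have "(\<lambda>x. w x * f x) absolutely_integrable_on {0..1}"
      using absolutely_integrable_mult_bounded[OF w(1) _ f] by simp
    then show "integrable unit_lebesgue (\<lambda>x. w x * f x)"
      by (simp add: set_integrable_def integrable_restrict_space)
  qed simp
  finally show ?thesis .
qed

lemma finite_measure_density_unit:
  fixes w :: "real \<Rightarrow> real"
  assumes w: "w absolutely_integrable_on {0..1}" "w \<in> borel_measurable borel" "\<And>x. x \<in> {0..1} \<Longrightarrow> 0 \<le> w x"
  shows "finite_measure (density unit_lebesgue (\<lambda>x. ennreal (w x)))"
proof
  have int: "integrable unit_lebesgue w"
    using w(1) by (simp add: set_integrable_def integrable_restrict_space)
  have "emeasure (density unit_lebesgue (\<lambda>x. ennreal (w x))) (space unit_lebesgue) = (\<integral>\<^sup>+x. ennreal (w x) \<partial>unit_lebesgue)"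
    using int by (subst emeasure_density) (auto intro!: nn_integral_cong)
  also have "\<dots> = ennreal (\<integral>x. w x \<partial>unit_lebesgue)"
    using int w(3) by (intro nn_integral_eq_integral) (auto intro!: AE_I2)
  finally show "emeasure (density unit_lebesgue (\<lambda>x. ennreal (w x))) (space (density unit_lebesgue (\<lambda>x. ennreal (w x)))) \<noteq> \<infinity>"
    by simp
qed

lemma seq_comp_range: "\<lbrakk>admissible \<alpha> a; x \<in> {0..1}\<rbrakk> \<Longrightarrow> seq_comp a n x \<in> {0..1}"
proof (induction n)
  case (Suc n)
  then show ?case using intermittent_map_range[of "a (Suc n)" "seq_comp a n x"] by (auto simp: admissible_def)
qed auto

text \<open>A common form for both measures: for Lebesgue measure the total mass is 1 and the
  centering becomes the plain mean. C precedes the quantifiers over \<phi>, a, p and n, which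
  expresses its uniformity.\<close>

definition deviation_estimates :: "real \<Rightarrow> real \<Rightarrow> real measure \<Rightarrow> real \<Rightarrow> bool" where
  "deviation_estimates \<alpha> K M C \<longleftrightarrow> (\<forall>\<phi> a p n.
     C1_on_unit \<phi> \<and> C1_norm \<phi> = K \<and> admissible \<alpha> a \<and> p > max 1 (1 / \<alpha> - 1) \<and> n \<ge> 2 \<longrightarrow>
     (let S = (\<lambda>x. \<Sum>j=1..n. \<phi> (seq_comp a j x) - 1 / measure M {0..1} * (\<integral>y. \<phi> (seq_comp a j y) \<partial>M));
          A = (4 * p / (1 - 1 / p * (1 / \<alpha> - 1))) powr p
      in (\<forall>\<epsilon>>0. measure M {x \<in> {0..1}. \<bar>S x\<bar> > real n * \<epsilon>}
            \<le> A * C powr p * real n powr (1 - 1 / \<alpha>) * ln (real n) powr (1 / \<alpha>) * \<epsilon> powr (- 2 * p)) \<and>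
         (\<integral>x. \<bar>S x\<bar> powr (2 * p) \<partial>M)
            \<le> A * C powr p * real n powr (2 * p + (1 - 1 / \<alpha>)) * ln (real n) powr (1 / \<alpha>)))"

lemma weighted_estimates:
  fixes \<alpha> K :: real and w :: "real \<Rightarrow> real"
  assumes \<alpha>: "0 < \<alpha>" "\<alpha> < 1"
    and w: "decr_density w" "w \<in> borel_measurable borel" "\<And>x. x \<in> {0..1} \<Longrightarrow> 0 \<le> w x"
    and wB: "initial_bound \<alpha> B w" "4 / (1 - \<alpha>) * integral {0..1} w \<le> B"
    and W: "1 \<le> integral {0..1} w"
  shows "\<exists>C>0. deviation_estimates \<alpha> K (density unit_lebesgue (\<lambda>x. ennreal (w x))) C"
proof -
  define M where "M = density unit_lebesgue (\<lambda>x. ennreal (w x))"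
  define s where "s = 1 / \<alpha> - 1"
  have s: "0 < s" "s + 1 = 1 / \<alpha>" "1 - 1 / \<alpha> = - s" using \<alpha> by (auto simp: s_def)
  define q where "q = max 1 s"
  \<comment> \<open>K is a prescribed value of the norm and a priori of any sign; decay of
    correlations asks for a nonnegative constant.\<close>
  define K' where "K' = \<bar>K\<bar>"
  have K': "0 \<le> K'" by (simp add: K'_def)
  define D where "D = 1 + 2 * K'"
  have D: "1 \<le> D" "2 * K' \<le> D" using K' by (auto simp: D_def)
  note wi = decr_densityD(1)[OF w(1)]
  interpret finite_measure M unfolding M_def by (rule finite_measure_density_unit[OF wi w(2,3)])
  have space_M [simp]: "space M = {0..1}" by (simp add: M_def)
  have meas: "g \<in> borel_measurable M" if "g \<in> borel_measurable borel" for g :: "real \<Rightarrow> real"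
    unfolding M_def using that by (simp, intro measurable_restrict_space1 measurable_completion) simp
  have int_M: "(\<integral>x. f x \<partial>M) = integral {0..1} (\<lambda>x. w x * f x)"
    if "f \<in> borel_measurable borel" "\<And>x. x \<in> {0..1} \<Longrightarrow> \<bar>f x\<bar> \<le> L" for f L
    unfolding M_def by (rule integral_density_unit[OF wi w(2,3) that])
  have W_M: "measure M {0..1} = integral {0..1} w"
    using int_M[of "\<lambda>_. 1" 1] by simp
  have W0: "0 < integral {0..1} w" using W by simp
  obtain Q0 where Q0: "0 \<le> Q0" "\<And>a \<phi> k n g L. \<lbrakk>admissible \<alpha> a; n \<ge> 1; \<phi> \<in> borel_measurable borel;
      \<And>x. \<bar>\<phi> x\<bar> \<le> K'; \<And>x y. \<bar>\<phi> x - \<phi> y\<bar> \<le> K' * \<bar>x - y\<bar>;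
      g \<in> borel_measurable borel; \<And>x. \<bar>g x\<bar> \<le> L\<rbrakk> \<Longrightarrow>
    \<bar>integral {0..1} (\<lambda>x. w x *
        ((\<phi> (seq_comp a k x) - integral {0..1} (\<lambda>x. w x * \<phi> (seq_comp a k x)) / integral {0..1} w)
          * g (seq_comp a (k + n) x)))\<bar> \<le> L * (Q0 * real n powr - (1 / \<alpha> - 1))"
    using decay_of_correlations[OF \<alpha> w(1) wB W0 K'] by blast
  \<comment> \<open>Strict positivity, because the moment inequality divides by the correlation
    bounds.\<close>
  define Q where "Q = Q0 + 1"
  have Q: "0 < Q" using Q0(1) by (simp add: Q_def)
  define c where "c = 2 powr (2 * q) * (2 * (2 * q)\<^sup>2 * D\<^sup>2 + D powr (2 * q)) * (integral {0..1} w + 1)"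
  have c: "0 \<le> c" unfolding c_def using W by (intro mult_nonneg_nonneg add_nonneg_nonneg) auto
  obtain C1 where C1: "0 < C1" "\<And>n. n \<ge> 2 \<Longrightarrow>
    (c * (real n * (1 + (\<Sum>j=1..n. (Q * real j powr - s) powr (1 / q))))) powr q
      \<le> C1 * real n powr (2 * q - s) * ln (real n) powr (s + 1)"
    using correlation_sum_bound[OF s(1) Q c] unfolding q_def by blast
  define C where "C = D\<^sup>2 * (C1 + 1)"
  have "0 < C" using D C1 by (simp add: C_def)
  have "deviation_estimates \<alpha> K M C"
    unfolding deviation_estimates_def
  proof (intro allI impI)
    fix \<phi>0 a p and n :: nat
    assume "C1_on_unit \<phi>0 \<and> C1_norm \<phi>0 = K \<and> admissible \<alpha> a \<and> p > max 1 (1 / \<alpha> - 1) \<and> n \<ge> 2"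
    then have C1n: "C1_on_unit \<phi>0" "C1_norm \<phi>0 = K" and adm: "admissible \<alpha> a"
      and p: "p > max 1 (1 / \<alpha> - 1)" and n: "n \<ge> 2" by auto
    define A where "A = (4 * p / (1 - 1 / p * (1 / \<alpha> - 1))) powr p"
    define S where "S = (\<lambda>x. \<Sum>j=1..n. \<phi>0 (seq_comp a j x)
      - 1 / measure M {0..1} * (\<integral>y. \<phi>0 (seq_comp a j y) \<partial>M))"
    note \<phi>0 = C1_on_unit_bounds[OF C1n]
    \<comment> \<open>The given observable is controlled on [0, 1] only. Clamping its argument
      yields a Borel function that is bounded and Lipschitz on the whole line and has the same
      values along orbits.\<close>
    define \<phi> where "\<phi> = (\<lambda>x. \<phi>0 (max 0 (min 1 x)))"
    have clamp: "max 0 (min 1 x) \<in> {0..1}" for x :: real by auto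
    have \<phi>_meas [measurable]: "\<phi> \<in> borel_measurable borel"
    proof (rule borel_measurable_continuous_onI)
      show "continuous_on UNIV \<phi>" unfolding \<phi>_def
        by (rule continuous_on_compose2[OF \<phi>0(3)]) (auto intro!: continuous_intros)
    qed
    have \<phi>_eq: "\<phi>0 x = \<phi> x" if "x \<in> {0..1}" for x using that by (simp add: \<phi>_def)
    have \<phi>_bound: "\<bar>\<phi> x\<bar> \<le> K'" for x unfolding \<phi>_def K'_def using \<phi>0(1)[OF clamp[of x]] by linarith
    have \<phi>_lip: "\<bar>\<phi> x - \<phi> y\<bar> \<le> K' * \<bar>x - y\<bar>" for x y
    proof -
      have "\<bar>\<phi> x - \<phi> y\<bar> \<le> K * \<bar>max 0 (min 1 x) - max 0 (min 1 y)\<bar>"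
        unfolding \<phi>_def by (rule \<phi>0(2)[OF clamp clamp])
      also have "\<dots> \<le> K' * \<bar>x - y\<bar>" unfolding K'_def by (intro mult_mono) auto
      finally show ?thesis .
    qed
    define T where "T = seq_comp a"
    have T_meas [measurable]: "T j \<in> borel_measurable borel" for j unfolding T_def by measurable
    define e where "e = (\<lambda>j. integral {0..1} (\<lambda>x. w x * \<phi> (T j x)) / integral {0..1} w)"
    define X where "X = (\<lambda>j x. \<phi> (T j x) - e j)"
    define R where "R = (\<lambda>i x. \<Sum>j=i..n. X j x)"
    have \<phi>T: "(\<lambda>x. \<phi> (T j x)) \<in> borel_measurable borel" for j by measurable
    have e_bound: "\<bar>e j\<bar> \<le> K'" for j
      using integral_mult_le[OF w(1) \<phi>T, of j K'] \<phi>_bound W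
      unfolding e_def abs_divide by (simp add: pos_divide_le_eq)
    have X_meas: "X j \<in> borel_measurable borel" for j unfolding X_def by measurable
    have X_bound: "\<bar>X j x\<bar> \<le> D" for j x
      using \<phi>_bound[of "T j x"] e_bound[of j] D unfolding X_def by linarith
    have R_meas: "R i \<in> borel_measurable borel" for i unfolding R_def using X_meas by measurable
    have corr: "\<bar>\<integral>x. X k x * h (R i x) (R (Suc i) x) \<partial>M\<bar> \<le> L * (Q * real (i - k) powr - s)"
      if k: "1 \<le> k" "k < i" "i \<le> n" and h: "case_prod h \<in> borel_measurable (borel \<Otimes>\<^sub>M borel)"
        "\<And>u v. \<bar>h u v\<bar> \<le> L" for k i h L
    proof -
      \<comment> \<open>All terms from index i on are functions of the state at time i. Thus R i and
        R (Suc i) are G i and G (Suc i) composed with T i, and h of the two becomes one bounded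
        function g of T i x.\<close>
      define G where "G = (\<lambda>i' y. \<Sum>j=i'..n. \<phi> (seq_comp (\<lambda>l. a (l + i)) (j - i) y) - e j)"
      have G_meas [measurable]: "G i' \<in> borel_measurable borel" for i' unfolding G_def by measurable
      have RG: "R i' x = G i' (T i x)" if "i \<le> i'" for i' x
        unfolding R_def G_def X_def T_def using that
        by (intro sum.cong refl) (simp add: seq_comp_add[symmetric])
      define g where "g = (\<lambda>y. h (G i y) (G (Suc i) y))"
      have g: "g \<in> borel_measurable borel" "\<And>y. \<bar>g y\<bar> \<le> L"
        using measurable_compose[OF _ h(1), of "\<lambda>y. (G i y, G (Suc i) y)" borel] h(2) by (auto simp: g_def)
      have L: "0 \<le> L" using h(2)[of 0 0] by linarith
      have "(\<integral>x. X k x * h (R i x) (R (Suc i) x) \<partial>M) = (\<integral>x. X k x * g (T i x) \<partial>M)"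
        by (simp add: RG g_def)
      also have "\<dots> = integral {0..1} (\<lambda>x. w x * (X k x * g (T i x)))"
      proof (rule int_M)
        show "(\<lambda>x. X k x * g (T i x)) \<in> borel_measurable borel" using X_meas g(1) by measurable
        show "\<bar>X k x * g (T i x)\<bar> \<le> D * L" for x
          unfolding abs_mult using X_bound g(2) D by (intro mult_mono) auto
      qed
      also have "\<bar>\<dots>\<bar> \<le> L * (Q0 * real (i - k) powr - s)"
        using Q0(2)[OF adm _ \<phi>_meas \<phi>_bound \<phi>_lip g, of "i - k" k] k
        unfolding X_def e_def T_def s_def by simp
      also have "\<dots> \<le> L * (Q * real (i - k) powr - s)"
        using L by (intro mult_left_mono mult_right_mono) (auto simp: Q_def)
      finally show ?thesis .
    qed
    have S_eq: "S x = R 1 x" if x: "x \<in> {0..1}" for x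
    proof -
      have "(\<integral>y. \<phi>0 (seq_comp a j y) \<partial>M) = integral {0..1} (\<lambda>x. w x * \<phi> (T j x))" for j
      proof -
        have "(\<integral>y. \<phi>0 (seq_comp a j y) \<partial>M) = (\<integral>y. \<phi> (T j y) \<partial>M)"
          using seq_comp_range[OF adm] by (intro Bochner_Integration.integral_cong refl) (simp add: T_def \<phi>_eq)
        also have "\<dots> = integral {0..1} (\<lambda>x. w x * \<phi> (T j x))"
          by (rule int_M[OF \<phi>T \<phi>_bound])
        finally show ?thesis .
      qed
      then show ?thesis
        unfolding S_def R_def X_def e_def W_M
        using seq_comp_range[OF adm x] by (intro sum.cong refl) (simp add: T_def \<phi>_eq)
    qed
    have R_bound: "\<bar>R 1 x\<bar> \<le> real n * D" for x
    proof -
      have "\<bar>R 1 x\<bar> \<le> (\<Sum>j=1..n. \<bar>X j x\<bar>)" unfolding R_def by (rule sum_abs)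
      also have "\<dots> \<le> (\<Sum>j=1..n. D)" using X_bound by (intro sum_mono) auto
      finally show ?thesis by simp
    qed
    have moment: "(\<integral>x. \<bar>R 1 x\<bar> powr (2 * q) \<partial>M) \<le> C1 * real n powr (2 * q - s) * ln (real n) powr (s + 1)"
    proof -
      have "(\<integral>x. \<bar>R 1 x\<bar> powr (2 * q) \<partial>M)
        \<le> (2 powr (2 * q) * (2 * (2 * q)\<^sup>2 * D\<^sup>2 + D powr (2 * q)) * (measure M (space M) + 1) *
          (real n * (1 + (\<Sum>j=1..n. (Q * real j powr - s) powr (1 / q))))) powr q"
      proof (rule moment_bound)
        show "1 \<le> q" by (simp add: q_def)
        show "1 \<le> measure M (space M)" using W W_M by simp
        show "1 \<le> n" using n by simp
        show "X j \<in> borel_measurable M" for j by (rule meas[OF X_meas])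
        show "0 < Q * real j powr - s" if "1 \<le> j" for j using that Q by simp
      qed (use D X_bound corr in \<open>auto simp: R_def\<close>)
      also have "\<dots> = (c * (real n * (1 + (\<Sum>j=1..n. (Q * real j powr - s) powr (1 / q))))) powr q"
        by (simp add: c_def W_M)
      also have "\<dots> \<le> C1 * real n powr (2 * q - s) * ln (real n) powr (s + 1)" by (rule C1(2)[OF n])
      finally show ?thesis .
    qed
    then have moment': "(\<integral>x. \<bar>R 1 x\<bar> powr (2 * q) \<partial>M) \<le> (C1 + 1) * real n powr (2 * q - s) * ln (real n) powr (s + 1)"
      by (rule order_trans) (intro mult_right_mono, auto)
    have qp: "q < p" using p by (simp add: q_def s_def)
    have C1': "1 \<le> C1 + 1" using C1 by simp
    note est = interpolated_moment_and_tail[OF meas[OF R_meas] R_bound D(1) C1' n s(1) q_def qp moment' A_def[folded s_def]]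
    have "{x \<in> {0..1}. \<bar>S x\<bar> > real n * \<epsilon>} = {x \<in> space M. \<bar>R 1 x\<bar> > real n * \<epsilon>}" for \<epsilon>
      using S_eq by auto
    moreover have "(\<integral>x. \<bar>S x\<bar> powr (2 * p) \<partial>M) = (\<integral>x. \<bar>R 1 x\<bar> powr (2 * p) \<partial>M)"
      by (intro Bochner_Integration.integral_cong refl) (simp add: S_eq)
    ultimately show "let S = (\<lambda>x. \<Sum>j=1..n. \<phi>0 (seq_comp a j x)
            - 1 / measure M {0..1} * (\<integral>y. \<phi>0 (seq_comp a j y) \<partial>M));
          A = (4 * p / (1 - 1 / p * (1 / \<alpha> - 1))) powr p
      in (\<forall>\<epsilon>>0. measure M {x \<in> {0..1}. \<bar>S x\<bar> > real n * \<epsilon>}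
            \<le> A * C powr p * real n powr (1 - 1 / \<alpha>) * ln (real n) powr (1 / \<alpha>) * \<epsilon> powr (- 2 * p)) \<and>
         (\<integral>x. \<bar>S x\<bar> powr (2 * p) \<partial>M)
            \<le> A * C powr p * real n powr (2 * p + (1 - 1 / \<alpha>)) * ln (real n) powr (1 / \<alpha>)"
      using est unfolding Let_def S_def[symmetric] A_def[symmetric] s(2,3) C_def by simp
  qed
  with \<open>0 < C\<close> show ?thesis unfolding M_def by blast
qed

lemma weight_powr:
  fixes \<alpha> :: real
  assumes \<alpha>: "0 \<le> \<alpha>" "\<alpha> < 1"
  shows "decr_density (\<lambda>x. x powr - \<alpha>)" "t \<in> {0..1} \<Longrightarrow> integral {0..t} (\<lambda>x. x powr - \<alpha>) = t powr (1 - \<alpha>) / (1 - \<alpha>)"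
proof -
  have hi: "((\<lambda>x. x powr - \<alpha>) has_integral (t powr (1 - \<alpha>) / (1 - \<alpha>))) {0..t}" if "0 \<le> t" for t
    using has_integral_powr_from_0[of "- \<alpha>" t] \<alpha> that by (simp add: algebra_simps)
  show "integral {0..t} (\<lambda>x. x powr - \<alpha>) = t powr (1 - \<alpha>) / (1 - \<alpha>)" if "t \<in> {0..1}"
    using hi[of t] that by auto
  have "(\<lambda>x. x powr - \<alpha>) absolutely_integrable_on {0..1}"
    using hi[of 1] by (subst absolutely_integrable_on_iff_nonneg) auto
  then show "decr_density (\<lambda>x. x powr - \<alpha>)"
    using \<alpha> by (auto simp: decr_density_def monotone_on_def intro!: powr_mono2')
qed

theorem theorem4p1:
  fixes \<alpha> K :: real
  assumes "0 < \<alpha>" and "\<alpha> < 1"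
  shows "\<exists>C>0. \<exists>C'>0. \<forall>(\<phi> :: real \<Rightarrow> real) (a :: nat \<Rightarrow> real) (p :: real) (n :: nat).
    C1_on_unit \<phi> \<and> C1_norm \<phi> = K \<and> (\<forall>j\<ge>1. 0 < a j \<and> a j \<le> \<alpha>) \<and>
    p > max 1 (1 / \<alpha> - 1) \<and> n \<ge> 2 \<longrightarrow>
    (let m = unit_lebesgue;
         m' = weighted_lebesgue \<alpha>;
         T = seq_comp a;
         S = (\<lambda>x. \<Sum>j=1..n. \<phi> (T j x) - (\<integral>y. \<phi> (T j y) \<partial>m));
         S' = (\<lambda>x. \<Sum>j=1..n. \<phi> (T j x) - 1 / measure m' {0..1} * (\<integral>y. \<phi> (T j y) \<partial>m'));
         A = (4 * p / (1 - 1 / p * (1 / \<alpha> - 1))) powr p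
     in (\<forall>\<epsilon>>0. measure m {x \<in> {0..1}. \<bar>S x\<bar> > real n * \<epsilon>}
            \<le> A * C powr p * real n powr (1 - 1 / \<alpha>) * ln (real n) powr (1 / \<alpha>)
               * \<epsilon> powr (- 2 * p)) \<and>
        (\<integral>x. \<bar>S x\<bar> powr (2 * p) \<partial>m)
            \<le> A * C powr p * real n powr (2 * p + (1 - 1 / \<alpha>)) * ln (real n) powr (1 / \<alpha>) \<and>
        (\<forall>\<epsilon>>0. measure m' {x \<in> {0..1}. \<bar>S' x\<bar> > real n * \<epsilon>}
            \<le> A * C' powr p * real n powr (1 - 1 / \<alpha>) * ln (real n) powr (1 / \<alpha>)
               * \<epsilon> powr (- 2 * p)) \<and>
        (\<integral>x. \<bar>S' x\<bar> powr (2 * p) \<partial>m')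
            \<le> A * C' powr p * real n powr (2 * p + (1 - 1 / \<alpha>)) * ln (real n) powr (1 / \<alpha>))"
proof -
  \<comment> \<open>One constant for both weights: \<open>x powr - \<alpha>\<close> has mass 1 / (1
    - \<alpha>), and B is 4 / (1 - \<alpha>) times that mass. It also exceeds 4 / (1 - \<alpha>),
    which the weight 1 asks for, and 1 / (1 - \<alpha>), the coefficient in the mass profile of
    \<open>x powr - \<alpha>\<close>.\<close>
  define B where "B = 4 / (1 - \<alpha>) / (1 - \<alpha>)"
  have inv: "1 \<le> 1 / (1 - \<alpha>)" using assms by (simp add: field_simps)
  have "4 / (1 - \<alpha>) * 1 \<le> 4 / (1 - \<alpha>) * (1 / (1 - \<alpha>))"
    using assms by (intro mult_left_mono inv) auto
  then have B4: "4 / (1 - \<alpha>) \<le> B" by (simp add: B_def)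
  moreover have "1 / (1 - \<alpha>) \<le> 4 / (1 - \<alpha>)" using assms by (intro divide_right_mono) auto
  ultimately have B: "4 / (1 - \<alpha>) \<le> B" "1 / (1 - \<alpha>) \<le> B" "1 \<le> B" using inv by linarith+
  have wi: "integral {0..t} (\<lambda>x. x powr - \<alpha>) = t powr (1 - \<alpha>) / (1 - \<alpha>)" if "t \<in> {0..1}" for t
    using weight_powr(2)[of \<alpha> t] assms that by simp
  have bound: "initial_bound \<alpha> B (\<lambda>x. x powr - \<alpha>)"
    unfolding initial_bound_def
  proof
    fix t :: real assume t: "t \<in> {0..1}"
    show "integral {0..t} (\<lambda>x. x powr - \<alpha>) \<le> B * t powr (1 - \<alpha>)"
      unfolding wi[OF t] using mult_right_mono[OF B(2), of "t powr (1 - \<alpha>)"] by simp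
  qed
  have bound1: "initial_bound \<alpha> B (\<lambda>x. 1)"
    unfolding initial_bound_def
  proof
    fix t :: real assume t: "t \<in> {0..1}"
    have "t powr 1 \<le> t powr (1 - \<alpha>)" using t assms by (intro powr_mono') auto
    also have "\<dots> \<le> B * t powr (1 - \<alpha>)" using B(3) mult_right_mono[of 1 B "t powr (1 - \<alpha>)"] by simp
    finally show "integral {0..t} (\<lambda>_. 1) \<le> B * t powr (1 - \<alpha>)" using t by simp
  qed
  have unit: "density unit_lebesgue (\<lambda>x. ennreal 1) = unit_lebesgue" by (simp add: density_1)
  have m1: "measure unit_lebesgue {0..1} = 1" by (simp add: measure_restrict_space)
  have w1: "(\<lambda>_. 1::real) \<in> borel_measurable borel"
    "4 / (1 - \<alpha>) * integral {0..1::real} (\<lambda>_. 1) \<le> B" "1 \<le> integral {0..1::real} (\<lambda>_. 1::real)"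
    using B by auto
  obtain C where C: "0 < C" "deviation_estimates \<alpha> K unit_lebesgue C"
    using weighted_estimates[OF assms decr_density_const[OF zero_le_one] w1(1) _ bound1 w1(2,3), where K = K]
    unfolding unit by auto
  have w2: "decr_density (\<lambda>x. x powr - \<alpha>)" "(\<lambda>x. x powr - \<alpha>) \<in> borel_measurable borel"
    "\<And>x. x \<in> {0..1} \<Longrightarrow> 0 \<le> x powr - \<alpha>"
    "4 / (1 - \<alpha>) * integral {0..1} (\<lambda>x. x powr - \<alpha>) \<le> B" "1 \<le> integral {0..1} (\<lambda>x. x powr - \<alpha>)"
    using weight_powr(1)[of \<alpha>] wi[of 1] inv assms by (auto simp: B_def)
  obtain C' where C': "0 < C'" "deviation_estimates \<alpha> K (weighted_lebesgue \<alpha>) C'"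
    using weighted_estimates[OF assms w2(1,2,3) bound w2(4,5), where K = K]
    unfolding weighted_lebesgue_def by auto
  show ?thesis
  proof (rule exI[of _ C], intro conjI C(1), rule exI[of _ C'], intro conjI C'(1) allI impI, goal_cases)
    case (1 \<phi> a p n)
    then have "C1_on_unit \<phi> \<and> C1_norm \<phi> = K \<and> admissible \<alpha> a \<and> p > max 1 (1 / \<alpha> - 1) \<and> n \<ge> 2"
      by (auto simp: admissible_def)
    note h = C(2)[unfolded deviation_estimates_def, rule_format, OF this]
      C'(2)[unfolded deviation_estimates_def, rule_format, OF this]
    show ?case using h unfolding Let_def m1 div_by_1 mult_1 by blast
  qed
qed

end
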